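(* Let $(W,S)$ be a Coxeter system, $w\in W$, let $\mathcal S=(J,H,M)$ be a system for $w$ and let $w=abc$ be an $\mathcal S$-factorization of $w$. Let $u\le w$ and $u=a'b'c'$ with $a',b',c'\in W$, $a'\le a$, $b'\le b$ and $c'\le c$. Assume that at least one of the following holds: (i) $\ell(u)=\ell(a')+\ell(b')+\ell(c')$; or (ii) $M_{\mathcal S}$ is a special matching of $w$ and there exists $r\in D_L(a)$ with $\ell(ru)=\ell(ra')+\ell(b')+\ell(c')$. Then $$M_{\mathcal S}(u)=a'\,M(b')\,c'.$$
   Context: $(W,S)$ is a Coxeter system with identity $e$, length function $\ell$ and Bruhat order $\le$; $x\lhd y$ means $y$ covers $x$, and $[e,w]=\{u\in W: u\le w\}$. $D_R(u)=\{r\in S:\ell(ur)<\ell(u)\}$, $D_L(u)=\{r\in S:\ell(ru)<\ell(u)\}$. For $J\subseteq S$, $W_J$ is the subgroup generated by $J$, $W^J=\{u: D_R(u)\cap J=\emptyset\}$, ${}^JW=\{u:D_L(u)\cap J=\emptyset\}$; each $u\in W$ factors uniquely as $u=u^Ju_J$ with $u^J\in W^J$, $u_J\in W_J$, and uniquely as $u={}_Ju\,{}^Ju$ with ${}_Ju\in W_J$, ${}^Ju\in{}^JW$ (iterated notation such as $(u^J)^H$ applies these operations successively). $\mathrm{Supp}(u)=\{r\in S: r\le u\}$, $\mathrm{Supp}_H(u)=\mathrm{Supp}(u)\cap H$, $C_s=\{c\in S: sc=cs\}$ (so $s\in C_s$). For $u\in W$ and $H\subseteq S$, $u_0(H)$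 denotes the unique maximal element of $[e,u]\cap W_H$. A matching of a poset $P$ is an involution $M:P\to P$ such that for every $v$ either $v\lhd M(v)$ or $M(v)\lhd v$; it is special if $u\lhd v$ and $M(u)\ne v$ imply $M(u)\le M(v)$. A (special) matching of $w$ is a (special) matching of the poset $[e,w]$. For $r\in D_L(w)$ (resp. $r\in D_R(w)$), $\lambda_r$ (resp. $\rho_r$) is the matching $u\mapsto ru$ (resp. $u\mapsto ur$) of $[e,w]$; these are called multiplication matchings. For a matching $M$ of $[e,w_0(H)]$, "$M$ commutes with $\lambda_\alpha$" means that $\alpha\in D_L(w_0(H))$ and $M(\alpha x)=\alpha M(x)$ for all $x\in[e,w_0(H)]$; "$M$ commutes with $\rho_\beta$" means $\beta\in D_R(w_0(H))$ and $M(x\beta)=M(x)\beta$ for all $x\in[e,w_0(H)]$. If $s\in S$ and $C_s\subseteq J\subseteq S$, the $s$-complement of $J$ is the unique $K\subseteq S$ with $J\cup K=S$ and $J\cap K=C_s$. A system for $w$ is a triple $\mathcal S=(J,H,M)$ with $H\subseteq S$, $|H|\in\{1,2\}$, $M$ a matching of $[e,w_0(H)]$, and $C_{M(e)}\subseteq J\subseteq S$, such that, with $K$ the $M(e)$-complement of $J$: [S0] $M$ is a multiplication matching of $[e,w_0(H)]$ if and only if $|H|=1$; [S1] $w^J\in W_K$ (equivalently ${}^Kw\in W_J$); [S2] $|\mathrm{Supp}_H((w^J)^H)|\le1$ and if $\alpha\in\mathrm{Supp}_H((w^J)^H)$ then $M$ commutes with $\lambda_\alpha$; $|\mathrm{Supp}_H({}^H({}^Kw))|\le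 1$ and if $\beta\in\mathrm{Supp}_H({}^H({}^Kw))$ then $M$ commutes with $\rho_\beta$. An $\mathcal S$-factorization of $u\in W$ is a factorization $u=abc$ with $\ell(u)=\ell(a)+\ell(b)+\ell(c)$ such that: $a\in W_K\cap W^H$, $|\mathrm{Supp}_H(a)|\le1$, and if $\alpha\in\mathrm{Supp}_H(a)$ then $M$ commutes with $\lambda_\alpha$; $b\in W_H$; $c\in W_J\cap{}^HW$, $|\mathrm{Supp}_H(c)|\le1$, and if $\beta\in\mathrm{Supp}_H(c)$ then $M$ commutes with $\rho_\beta$. The map $M_{\mathcal S}$ on $[e,w]$: $M_{\mathcal S}(u)=a\,M(b)\,c$ where $u=abc$ is an arbitrary $\mathcal S$-factorization of $u$ (one exists and the result does not depend on the choice). Concretely, since $s=M(e)\in H$, one has $H\subseteq K$ or $H\subseteq J$. If $H\subseteq K$ one may take $a=(u^J)^H$, $b=(u^J)_H\,{}_H(u_J)$, $c={}^H(u_J)$; if $H\subseteq J$ one may take $a=({}_Ku)^H$, $b=({}_Ku)_H\,{}_H({}^Ku)$, $c={}^H({}^Ku)$. *)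

theory Defs
  imports "HOL-Algebra.Algebra"
begin

section \<open>Coxeter systems\<close>

definition word_prod :: "('a, 'b) monoid_scheme \<Rightarrow> 'a list \<Rightarrow> 'a" where
  "word_prod W xs = foldr (\<otimes>\<^bsub>W\<^esub>) xs \<one>\<^bsub>W\<^esub>"

text \<open>
  The congruence on words over \<open>S\<close> generated by \<open>(st)\<^sup>m = 1\<close>, where \<open>m\<close> is the order of
  \<open>st\<close> in \<open>W\<close>. If that order is infinite, \<^const>\<open>group.ord\<close> is \<open>0\<close> and no relation is imposed.
  The case \<open>s = t\<close> gives \<open>ss = 1\<close>, so the quotient of the free monoid by this
  congruence is already the group presented by these generators and relations.
\<close>

inductive coxeter_congruent ::
    "('a, 'b) monoid_scheme \<Rightarrow> 'a set \<Rightarrow> 'a list \<Rightarrow> 'a list \<Rightarrow> bool"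
  for W S where
  rel: "\<lbrakk>xs \<in> lists S; ys \<in> lists S; s \<in> S; t \<in> S\<rbrakk> \<Longrightarrow>
    coxeter_congruent W S
      (xs @ concat (replicate (group.ord W (s \<otimes>\<^bsub>W\<^esub> t)) [s, t]) @ ys) (xs @ ys)"
| refl: "xs \<in> lists S \<Longrightarrow> coxeter_congruent W S xs xs"
| sym: "coxeter_congruent W S xs ys \<Longrightarrow> coxeter_congruent W S ys xs"
| trans: "\<lbrakk>coxeter_congruent W S xs ys; coxeter_congruent W S ys zs\<rbrakk> \<Longrightarrow>
    coxeter_congruent W S xs zs"

locale coxeter_system = group W for W (structure) +
  fixes S :: "'a set"
  assumes gens_closed: "S \<subseteq> carrier W"
    and gens_generate: "generate W S = carrier W"
    and gens_order: "s \<in> S \<Longrightarrow> ord s = 2"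
    and presentation:
      "\<lbrakk>xs \<in> lists S; ys \<in> lists S; word_prod W xs = word_prod W ys\<rbrakk> \<Longrightarrow>
        coxeter_congruent W S xs ys"

definition cox_length :: "('a, 'b) monoid_scheme \<Rightarrow> 'a set \<Rightarrow> 'a \<Rightarrow> nat" where
  "cox_length W S u = (LEAST n. \<exists>xs \<in> lists S. length xs = n \<and> word_prod W xs = u)"

definition reflections :: "('a, 'b) monoid_scheme \<Rightarrow> 'a set \<Rightarrow> 'a set" where
  "reflections W S = {x \<otimes>\<^bsub>W\<^esub> s \<otimes>\<^bsub>W\<^esub> inv\<^bsub>W\<^esub> x | x s. x \<in> carrier W \<and> s \<in> S}"

definition bruhat_step :: "('a, 'b) monoid_scheme \<Rightarrow> 'a set \<Rightarrow> 'a \<Rightarrow> 'a \<Rightarrow> bool" where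
  "bruhat_step W S u v \<longleftrightarrow> u \<in> carrier W \<and>
     (\<exists>t \<in> reflections W S. v = u \<otimes>\<^bsub>W\<^esub> t \<and> cox_length W S u < cox_length W S v)"

definition bruhat_le :: "('a, 'b) monoid_scheme \<Rightarrow> 'a set \<Rightarrow> 'a \<Rightarrow> 'a \<Rightarrow> bool" where
  "bruhat_le W S u v \<longleftrightarrow> u \<in> carrier W \<and> v \<in> carrier W \<and> (bruhat_step W S)\<^sup>*\<^sup>* u v"

definition lower_interval :: "('a, 'b) monoid_scheme \<Rightarrow> 'a set \<Rightarrow> 'a \<Rightarrow> 'a set" where
  "lower_interval W S w = {u. bruhat_le W S u w}"

definition right_descents :: "('a, 'b) monoid_scheme \<Rightarrow> 'a set \<Rightarrow> 'a \<Rightarrow> 'a set" where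
  "right_descents W S u = {r \<in> S. cox_length W S (u \<otimes>\<^bsub>W\<^esub> r) < cox_length W S u}"

definition left_descents :: "('a, 'b) monoid_scheme \<Rightarrow> 'a set \<Rightarrow> 'a \<Rightarrow> 'a set" where
  "left_descents W S u = {r \<in> S. cox_length W S (r \<otimes>\<^bsub>W\<^esub> u) < cox_length W S u}"


section \<open>Parabolic subgroups and quotients\<close>

text \<open>The parabolic subgroup \<open>W\<^sub>J\<close> is \<^const>\<open>generate\<close> \<open>W J\<close>.\<close>

text \<open>\<open>W\<^sup>J\<close>\<close>
definition min_right :: "('a, 'b) monoid_scheme \<Rightarrow> 'a set \<Rightarrow> 'a set \<Rightarrow> 'a set" where
  "min_right W S J = {u \<in> carrier W. right_descents W S u \<inter> J = {}}"

text \<open>\<open>\<^sup>JW\<close>\<close>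
definition min_left :: "('a, 'b) monoid_scheme \<Rightarrow> 'a set \<Rightarrow> 'a set \<Rightarrow> 'a set" where
  "min_left W S J = {u \<in> carrier W. left_descents W S u \<inter> J = {}}"

text \<open>\<open>u\<^sup>J\<close>, from the unique factorization \<open>u = u\<^sup>J u\<^sub>J\<close>\<close>
definition proj_right :: "('a, 'b) monoid_scheme \<Rightarrow> 'a set \<Rightarrow> 'a set \<Rightarrow> 'a \<Rightarrow> 'a" where
  "proj_right W S J u =
     (THE v. v \<in> min_right W S J \<and> (\<exists>x \<in> generate W J. u = v \<otimes>\<^bsub>W\<^esub> x))"

text \<open>\<open>\<^sup>Ju\<close>, from the unique factorization \<open>u = \<^sub>Ju \<^sup>Ju\<close>\<close>
definition proj_left :: "('a, 'b) monoid_scheme \<Rightarrow> 'a set \<Rightarrow> 'a set \<Rightarrow> 'a \<Rightarrow> 'a" where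
  "proj_left W S J u =
     (THE v. v \<in> min_left W S J \<and> (\<exists>x \<in> generate W J. u = x \<otimes>\<^bsub>W\<^esub> v))"

definition supp :: "('a, 'b) monoid_scheme \<Rightarrow> 'a set \<Rightarrow> 'a \<Rightarrow> 'a set" where
  "supp W S u = {r \<in> S. bruhat_le W S r u}"

definition commuting_gens :: "('a, 'b) monoid_scheme \<Rightarrow> 'a set \<Rightarrow> 'a \<Rightarrow> 'a set" where
  "commuting_gens W S s = {c \<in> S. s \<otimes>\<^bsub>W\<^esub> c = c \<otimes>\<^bsub>W\<^esub> s}"

text \<open>\<open>u\<^sub>0(H)\<close>, the unique maximal element of \<open>[e, u] \<inter> W\<^sub>H\<close>\<close>
definition max_parabolic :: "('a, 'b) monoid_scheme \<Rightarrow> 'a set \<Rightarrow> 'a set \<Rightarrow> 'a \<Rightarrow> 'a" where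
  "max_parabolic W S H u =
     (THE x. x \<in> lower_interval W S u \<inter> generate W H \<and>
        (\<forall>y \<in> lower_interval W S u \<inter> generate W H. bruhat_le W S x y \<longrightarrow> y = x))"

definition complement :: "('a, 'b) monoid_scheme \<Rightarrow> 'a set \<Rightarrow> 'a \<Rightarrow> 'a set \<Rightarrow> 'a set" where
  "complement W S s J = (THE K. K \<subseteq> S \<and> J \<union> K = S \<and> J \<inter> K = commuting_gens W S s)"

lemma complement_eq:
  assumes "commuting_gens W S s \<subseteq> J" "J \<subseteq> S"
  shows "complement W S s J = (S - J) \<union> commuting_gens W S s"
  unfolding complement_def by (rule the_equality) (use assms in blast)+


section \<open>Matchings\<close>

definition covers_in :: "'a set \<Rightarrow> ('a \<Rightarrow> 'a \<Rightarrow> bool) \<Rightarrow> 'a \<Rightarrow> 'a \<Rightarrow> bool" where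
  "covers_in P leq x y \<longleftrightarrow> x \<in> P \<and> y \<in> P \<and> leq x y \<and> x \<noteq> y \<and>
     (\<forall>z \<in> P. leq x z \<and> leq z y \<longrightarrow> z = x \<or> z = y)"

definition matching :: "'a set \<Rightarrow> ('a \<Rightarrow> 'a \<Rightarrow> bool) \<Rightarrow> ('a \<Rightarrow> 'a) \<Rightarrow> bool" where
  "matching P leq M \<longleftrightarrow>
     (\<forall>v \<in> P. M v \<in> P \<and> M (M v) = v \<and> (covers_in P leq v (M v) \<or> covers_in P leq (M v) v))"

definition special_matching :: "'a set \<Rightarrow> ('a \<Rightarrow> 'a \<Rightarrow> bool) \<Rightarrow> ('a \<Rightarrow> 'a) \<Rightarrow> bool" where
  "special_matching P leq M \<longleftrightarrow> matching P leq M \<and>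
     (\<forall>u \<in> P. \<forall>v \<in> P. covers_in P leq u v \<and> M u \<noteq> v \<longrightarrow> leq (M u) (M v))"

abbreviation matching_of ::
    "('a, 'b) monoid_scheme \<Rightarrow> 'a set \<Rightarrow> 'a \<Rightarrow> ('a \<Rightarrow> 'a) \<Rightarrow> bool" where
  "matching_of W S w M \<equiv> matching (lower_interval W S w) (bruhat_le W S) M"

abbreviation special_matching_of ::
    "('a, 'b) monoid_scheme \<Rightarrow> 'a set \<Rightarrow> 'a \<Rightarrow> ('a \<Rightarrow> 'a) \<Rightarrow> bool" where
  "special_matching_of W S w M \<equiv> special_matching (lower_interval W S w) (bruhat_le W S) M"

text \<open>Matchings are total functions; only their values on the poset matter, so
  multiplication matchings are recognised by their values on \<open>[e, w]\<close>.\<close>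
definition multiplication_matching_of ::
    "('a, 'b) monoid_scheme \<Rightarrow> 'a set \<Rightarrow> 'a \<Rightarrow> ('a \<Rightarrow> 'a) \<Rightarrow> bool" where
  "multiplication_matching_of W S w M \<longleftrightarrow>
     (\<exists>r \<in> left_descents W S w. \<forall>x \<in> lower_interval W S w. M x = r \<otimes>\<^bsub>W\<^esub> x) \<or>
     (\<exists>r \<in> right_descents W S w. \<forall>x \<in> lower_interval W S w. M x = x \<otimes>\<^bsub>W\<^esub> r)"

definition commutes_with_left ::
    "('a, 'b) monoid_scheme \<Rightarrow> 'a set \<Rightarrow> 'a \<Rightarrow> ('a \<Rightarrow> 'a) \<Rightarrow> 'a \<Rightarrow> bool" where
  "commutes_with_left W S w M \<alpha> \<longleftrightarrow> \<alpha> \<in> left_descents W S w \<and>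
     (\<forall>x \<in> lower_interval W S w. M (\<alpha> \<otimes>\<^bsub>W\<^esub> x) = \<alpha> \<otimes>\<^bsub>W\<^esub> M x)"

definition commutes_with_right ::
    "('a, 'b) monoid_scheme \<Rightarrow> 'a set \<Rightarrow> 'a \<Rightarrow> ('a \<Rightarrow> 'a) \<Rightarrow> 'a \<Rightarrow> bool" where
  "commutes_with_right W S w M \<beta> \<longleftrightarrow> \<beta> \<in> right_descents W S w \<and>
     (\<forall>x \<in> lower_interval W S w. M (x \<otimes>\<^bsub>W\<^esub> \<beta>) = M x \<otimes>\<^bsub>W\<^esub> \<beta>)"


section \<open>Systems\<close>

definition is_system ::
    "('a, 'b) monoid_scheme \<Rightarrow> 'a set \<Rightarrow> 'a \<Rightarrow> 'a set \<Rightarrow> 'a set \<Rightarrow> ('a \<Rightarrow> 'a) \<Rightarrow> bool" where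
  "is_system W S w J H M \<longleftrightarrow>
    (let w0 = max_parabolic W S H w;
         s = M \<one>\<^bsub>W\<^esub>;
         K = complement W S s J;
         A = supp W S (proj_right W S H (proj_right W S J w)) \<inter> H;
         B = supp W S (proj_left W S H (proj_left W S K w)) \<inter> H
     in H \<subseteq> S \<and> card H \<in> {1, 2} \<and>
        matching_of W S w0 M \<and>
        commuting_gens W S s \<subseteq> J \<and> J \<subseteq> S \<and>
        (multiplication_matching_of W S w0 M \<longleftrightarrow> card H = 1) \<and>
        proj_right W S J w \<in> generate W K \<and>
        card A \<le> 1 \<and> (\<forall>\<alpha> \<in> A. commutes_with_left W S w0 M \<alpha>) \<and>
        card B \<le> 1 \<and> (\<forall>\<beta> \<in> B. commutes_with_right W S w0 M \<beta>))"

text \<open>\<open>u = abc\<close> is an \<open>(J, H, M)\<close>-factorization; the element \<open>w\<close> enters through the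
  domain \<open>[e, w\<^sub>0(H)]\<close> of \<open>M\<close>.\<close>
definition system_factorization ::
    "('a, 'b) monoid_scheme \<Rightarrow> 'a set \<Rightarrow> 'a \<Rightarrow> 'a set \<Rightarrow> 'a set \<Rightarrow> ('a \<Rightarrow> 'a) \<Rightarrow>
     'a \<Rightarrow> 'a \<Rightarrow> 'a \<Rightarrow> 'a \<Rightarrow> bool" where
  "system_factorization W S w J H M u a b c \<longleftrightarrow>
    (let w0 = max_parabolic W S H w;
         K = complement W S (M \<one>\<^bsub>W\<^esub>) J;
         A = supp W S a \<inter> H;
         B = supp W S c \<inter> H
     in u = a \<otimes>\<^bsub>W\<^esub> b \<otimes>\<^bsub>W\<^esub> c \<and>
        cox_length W S u = cox_length W S a + cox_length W S b + cox_length W S c \<and>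
        a \<in> generate W K \<inter> min_right W S H \<and>
        card A \<le> 1 \<and> (\<forall>\<alpha> \<in> A. commutes_with_left W S w0 M \<alpha>) \<and>
        b \<in> generate W H \<and>
        c \<in> generate W J \<inter> min_left W S H \<and>
        card B \<le> 1 \<and> (\<forall>\<beta> \<in> B. commutes_with_right W S w0 M \<beta>))"

text \<open>The common value of \<open>a M(b) c\<close> over all factorizations \<open>u = abc\<close>; meaningful for
  \<open>u \<in> [e, w]\<close>, where a factorization exists and the value does not depend on it.\<close>
definition system_map ::
    "('a, 'b) monoid_scheme \<Rightarrow> 'a set \<Rightarrow> 'a \<Rightarrow> 'a set \<Rightarrow> 'a set \<Rightarrow> ('a \<Rightarrow> 'a) \<Rightarrow> 'a \<Rightarrow> 'a" where
  "system_map W S w J H M u =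
     (THE v. \<exists>a b c. system_factorization W S w J H M u a b c \<and>
        v = a \<otimes>\<^bsub>W\<^esub> M b \<otimes>\<^bsub>W\<^esub> c)"

end

(*
  Let s = M(e). Call u = abc a loose factorization if it satisfies the conditions of an
  S-factorization except that a and c need not be minimal coset representatives; A and B are sets of
  at most one element of H, commuting with M, that contain Supp_H(a) and Supp_H(c). In case (i)
  u = a'b'c' is a loose factorization, and moving the H-parts of a' and c' into b' makes it an
  S-factorization with the same value a' M(b') c'. So (i) amounts to a M(b) c being independent of
  the loose factorization. By inversion assume that H is contained in K. A generator g in J \<inter> K
  outside H that is a right descent of ab can be moved to c: it cancels a letter of a, hence
  b g b^-1 lies in the parabolic subgroup generated by A and g, and a computation in W_H shows
  that then b^-1 M(b) commutes with g. Once this is no longer possible, ab = d or ab = ds with d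
  minimal in its coset of W_J, which determines ab and c, and hence the value.

  Case (ii) reduces to (i) because left multiplication by a generator r in Supp(a) commutes with
  a M(b) c on factorizations whose left factor is supported in Supp(a). In normal form this follows
  by examining whether ra and r(ab) are again minimal coset representatives.
*)
theory Submission
  imports Defs
begin

text \<open>The computation in W_H rests on a centralizer. A generator g in J \<inter> K commutes
  with s; if g lies outside H and does not commute with all of H, then only e and s can commute with
  it in W_H (\<open>commuting_element\<close>). If moreover b g b^-1 lies in the parabolic subgroup
  of A \<union> {g}, then b is y or ys with y in W_A, and on such elements M is right multiplication
  by s.

  The bounds A and B are parameters rather than exact supports because they have to survive every
  move: letters of a get cancelled, and case (ii) multiplies by an r that need not occur in a'.

  Inversion reduces independence to one position of H, but it turns left multiplication into right
  multiplication. For case (ii) the position H \<subseteq> J therefore needs its own argument.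

  One dichotomy, \<open>min_right_gen_cases\<close>, does most of the work: rv is again minimal in
  its coset or rv = vj. It is applied modulo H, J \<inter> K - H, A \<union> {g} and {g, t}.\<close>

section \<open>Words, reflections and the exchange property\<close>

lemma word_prod_Nil [simp]: "word_prod W [] = \<one>\<^bsub>W\<^esub>"
  by (simp add: word_prod_def)

lemma word_prod_Cons [simp]: "word_prod W (x # xs) = x \<otimes>\<^bsub>W\<^esub> word_prod W xs"
  by (simp add: word_prod_def)

context coxeter_system
begin

abbreviation len :: "'a \<Rightarrow> nat" where "len \<equiv> cox_length W S"
abbreviation para :: "'a set \<Rightarrow> 'a set" where "para \<equiv> generate W"
abbreviation refls :: "'a set" where "refls \<equiv> reflections W S"
abbreviation ble :: "'a \<Rightarrow> 'a \<Rightarrow> bool" (infix \<open>\<preceq>\<close> 50) where "ble \<equiv> bruhat_le W S"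

lemma gen_closed [simp]: "s \<in> S \<Longrightarrow> s \<in> carrier W"
  using gens_closed by blast

lemma gen_sq: "s \<in> S \<Longrightarrow> s \<otimes> s = \<one>"
  using pow_ord_eq_1[of s] gens_order[of s] by (simp add: numeral_2_eq_2)

lemma gen_inv [simp]: "s \<in> S \<Longrightarrow> inv s = s"
  by (rule inv_equality) (auto simp: gen_sq)

lemma gen_cancel [simp]: "s \<in> S \<Longrightarrow> x \<in> carrier W \<Longrightarrow> s \<otimes> (s \<otimes> x) = x"
  by (simp add: m_assoc[symmetric] gen_sq)

lemma gen_cancel_right [simp]: "s \<in> S \<Longrightarrow> x \<in> carrier W \<Longrightarrow> x \<otimes> s \<otimes> s = x"
  by (simp add: m_assoc gen_sq)

lemma gen_neq_one: "s \<in> S \<Longrightarrow> s \<noteq> \<one>"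
  using gens_order[of s] ord_id by auto

lemma inv_cancel_left [simp]:
  "x \<in> carrier W \<Longrightarrow> y \<in> carrier W \<Longrightarrow> inv x \<otimes> (x \<otimes> y) = y"
  "x \<in> carrier W \<Longrightarrow> y \<in> carrier W \<Longrightarrow> x \<otimes> (inv x \<otimes> y) = y"
  by (simp_all add: m_assoc[symmetric])

lemma word_prod_closed [simp]: "xs \<in> lists S \<Longrightarrow> word_prod W xs \<in> carrier W"
  by (induction xs) auto

lemma word_prod_append [simp]:
  "xs \<in> lists S \<Longrightarrow> ys \<in> lists S \<Longrightarrow>
    word_prod W (xs @ ys) = word_prod W xs \<otimes> word_prod W ys"
  by (induction xs) (auto simp: m_assoc)

lemma word_prod_rev: "xs \<in> lists S \<Longrightarrow> word_prod W (rev xs) = inv (word_prod W xs)"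
proof (induction xs)
  case (Cons x xs)
  then have "rev xs \<in> lists S" by auto
  with Cons show ?case by (simp add: inv_mult_group)
qed auto

lemma para_iff_word:
  assumes "J \<subseteq> S"
  shows "u \<in> para J \<longleftrightarrow> (\<exists>xs \<in> lists J. word_prod W xs = u)"
proof
  assume "u \<in> para J"
  then show "\<exists>xs \<in> lists J. word_prod W xs = u"
  proof induction
    case one
    then show ?case by (rule bexI[of _ "[]"]) auto
  next
    case (incl h)
    then show ?case using assms by (intro bexI[of _ "[h]"]) auto
  next
    case (inv h)
    then show ?case using assms by (intro bexI[of _ "[h]"]) auto
  next
    case (eng h1 h2)
    then obtain xs ys where "xs \<in> lists J" "ys \<in> lists J" "word_prod W xs = h1" "word_prod W ys = h2"
      by auto
    moreover from this assms have "xs \<in> lists S" "ys \<in> lists S" by auto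
    ultimately show ?case by (intro bexI[of _ "xs @ ys"]) auto
  qed
next
  assume "\<exists>xs \<in> lists J. word_prod W xs = u"
  then obtain xs where "xs \<in> lists J" "word_prod W xs = u" by auto
  then show "u \<in> para J"
    by (induction xs arbitrary: u) (auto intro: generate.intros)
qed

lemma carrier_iff_word: "u \<in> carrier W \<longleftrightarrow> (\<exists>xs \<in> lists S. word_prod W xs = u)"
  using para_iff_word[of S] gens_generate by simp

lemma para_closed: "J \<subseteq> S \<Longrightarrow> u \<in> para J \<Longrightarrow> u \<in> carrier W"
  using generate_in_carrier[of J u] gens_closed by auto

lemma para_inv: "J \<subseteq> S \<Longrightarrow> u \<in> para J \<Longrightarrow> inv u \<in> para J"
  using generate_m_inv_closed gens_closed by blast

lemma para_inv_iff: "J \<subseteq> S \<Longrightarrow> u \<in> carrier W \<Longrightarrow> inv u \<in> para J \<longleftrightarrow> u \<in> para J"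
  using para_inv[of J u] para_inv[of J "inv u"] by auto

lemma para_mult: "u \<in> para J \<Longrightarrow> v \<in> para J \<Longrightarrow> u \<otimes> v \<in> para J"
  by (rule generate.eng)

lemma para_gen: "j \<in> J \<Longrightarrow> j \<in> para J"
  by (rule generate.incl)

lemma para_one: "\<one> \<in> para J"
  by (rule generate.one)

lemma para_mono: "J \<subseteq> K \<Longrightarrow> u \<in> para J \<Longrightarrow> u \<in> para K"
  using mono_generate by blast

lemma reduced_word:
  assumes "u \<in> carrier W"
  obtains xs where "xs \<in> lists S" "length xs = len u" "word_prod W xs = u"
proof -
  have "\<exists>n. \<exists>xs \<in> lists S. length xs = n \<and> word_prod W xs = u"
    using assms carrier_iff_word by blast
  from LeastI_ex[OF this] show ?thesis using that unfolding cox_length_def by blast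
qed

lemma len_word_le: "xs \<in> lists S \<Longrightarrow> len (word_prod W xs) \<le> length xs"
  unfolding cox_length_def by (rule Least_le) auto

lemma len_one [simp]: "len \<one> = 0"
  using len_word_le[of "[]"] by simp

lemma len_eq_0_iff: "u \<in> carrier W \<Longrightarrow> len u = 0 \<longleftrightarrow> u = \<one>"
  using reduced_word[of u] by force

lemma len_mult_le:
  assumes "u \<in> carrier W" "v \<in> carrier W"
  shows "len (u \<otimes> v) \<le> len u + len v"
proof -
  obtain xs ys where "xs \<in> lists S" "length xs = len u" "word_prod W xs = u"
    "ys \<in> lists S" "length ys = len v" "word_prod W ys = v"
    using reduced_word assms by metis
  then show ?thesis using len_word_le[of "xs @ ys"] by auto
qed

lemma len_gen: "s \<in> S \<Longrightarrow> len s = 1"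
  using len_word_le[of "[s]"] len_eq_0_iff[of s] gen_neq_one[of s] by (auto simp: le_Suc_eq)

lemma len_inv_le: "u \<in> carrier W \<Longrightarrow> len (inv u) \<le> len u"
proof -
  assume "u \<in> carrier W"
  then obtain xs where "xs \<in> lists S" "length xs = len u" "word_prod W xs = u"
    using reduced_word by metis
  moreover from this have "rev xs \<in> lists S" by auto
  ultimately show ?thesis using len_word_le[of "rev xs"] word_prod_rev[of xs] by simp
qed

lemma len_inv [simp]: "u \<in> carrier W \<Longrightarrow> len (inv u) = len u"
  using len_inv_le[of u] len_inv_le[of "inv u"] by simp

text \<open>The parity of the number of \<open>i\<close> with \<open>t = s\<^sub>1 \<dots> s\<^sub>i \<dots> s\<^sub>1\<close>, for the word \<open>s\<^sub>1 \<dots> s\<^sub>k\<close>.\<close>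

fun refl_parity :: "'a list \<Rightarrow> 'a \<Rightarrow> bool" where
  "refl_parity [] t = False"
| "refl_parity (s # xs) t = ((t = s) \<noteq> refl_parity xs (s \<otimes> t \<otimes> s))"

text \<open>Cocycle identity: within the longer word, the reflections attached to the letters of
  \<open>ys\<close> are those of \<open>ys\<close> alone, conjugated by the product of
  \<open>xs\<close>.\<close>

lemma refl_parity_append:
  assumes "xs \<in> lists S" "ys \<in> lists S" "t \<in> carrier W"
  shows "refl_parity (xs @ ys) t =
    (refl_parity xs t \<noteq> refl_parity ys (inv (word_prod W xs) \<otimes> t \<otimes> word_prod W xs))"
  using assms
proof (induction xs arbitrary: t)
  case (Cons s xs)
  then have "s \<in> S" "xs \<in> lists S" by auto
  then show ?case using Cons by (auto simp: inv_mult_group m_assoc)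
qed simp

lemma word_prod_alternating:
  "s \<in> S \<Longrightarrow> t \<in> S \<Longrightarrow> word_prod W (concat (replicate k [s, t])) = (s \<otimes> t) [^] k"
proof (induction k)
  case (Suc k)
  then have "(s \<otimes> t) [^] Suc k = s \<otimes> t \<otimes> (s \<otimes> t) [^] k"
    by (intro nat_pow_Suc2) simp
  with Suc show ?case by (simp add: m_assoc del: nat_pow_Suc)
qed simp

lemma gen_conj_eq_iff:
  assumes "s \<in> S" "y \<in> carrier W" "t \<in> carrier W"
  shows "s \<otimes> y \<otimes> s = t \<longleftrightarrow> y = s \<otimes> t \<otimes> s"
  using assms by (auto simp: m_assoc gen_sq)

lemma gen_conj_pow:
  assumes "s \<in> S" "t \<in> S"
  shows "s \<otimes> inv ((s \<otimes> t) [^] (k::nat)) = (s \<otimes> t) [^] k \<otimes> s"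
proof (induction k)
  case (Suc k)
  have "s \<otimes> inv ((s \<otimes> t) [^] Suc k) = s \<otimes> (inv (s \<otimes> t) \<otimes> inv ((s \<otimes> t) [^] k))"
    using assms by (simp add: inv_mult_group)
  also have "\<dots> = s \<otimes> t \<otimes> (s \<otimes> inv ((s \<otimes> t) [^] k))"
    using assms by (simp add: inv_mult_group m_assoc)
  also have "\<dots> = s \<otimes> t \<otimes> (s \<otimes> t) [^] k \<otimes> s"
    using assms unfolding Suc by (simp add: m_assoc)
  also have "s \<otimes> t \<otimes> (s \<otimes> t) [^] k = (s \<otimes> t) [^] Suc k"
    by (intro nat_pow_Suc2[symmetric]) (use assms in simp)
  finally show ?case .
qed (use assms in simp)

lemma alternating_in_lists:
  "s \<in> S \<Longrightarrow> t \<in> S \<Longrightarrow> concat (replicate k [s, t]) \<in> lists S"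
  by (induction k) auto

lemma concat_replicate_Suc_right:
  "concat (replicate (Suc k) xs) = concat (replicate k xs) @ xs"
  by (induction k) auto

text \<open>The reflections read off from the word stst... are (st)^i s, in this order. Each step of
  the induction appends those with exponents 2k and 2k+1.\<close>

lemma refl_parity_alternating:
  assumes "s \<in> S" "t \<in> S" "x \<in> carrier W"
  shows "refl_parity (concat (replicate k [s, t])) x \<longleftrightarrow>
    odd (\<Sum>i<2*k. of_bool (x = (s \<otimes> t) [^] i \<otimes> s) :: nat)"
proof (induction k)
  case (Suc k)
  let ?z = "s \<otimes> t" and ?u = "concat (replicate k [s, t])"
  have z: "?z \<in> carrier W" using assms by simp
  have u: "?u \<in> lists S" using assms alternating_in_lists by blast
  let ?y = "inv (?z [^] k) \<otimes> x \<otimes> ?z [^] k"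
  have zk: "?z [^] k \<in> carrier W" using z by simp
  have conj: "?y = v \<longleftrightarrow> x = ?z [^] k \<otimes> v \<otimes> inv (?z [^] k)" if "v \<in> carrier W" for v
    using that zk assms(3) by (auto simp: m_assoc simp del: nat_pow_closed)
  have 1: "?y = s \<longleftrightarrow> x = ?z [^] (2*k) \<otimes> s"
    using assms z unfolding conj[OF gen_closed[OF assms(1)]]
    by (simp add: m_assoc gen_conj_pow nat_pow_mult mult_2 flip: m_assoc[of "?z [^] k" "?z [^] k" s])
  have "s \<otimes> ?y \<otimes> s = t \<longleftrightarrow> ?y = s \<otimes> t \<otimes> s"
    using assms z by (intro gen_conj_eq_iff) auto
  also have "\<dots> \<longleftrightarrow> x = ?z [^] k \<otimes> (?z \<otimes> (s \<otimes> inv (?z [^] k)))"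
    using assms z by (subst conj) (auto simp: m_assoc)
  also have "\<dots> \<longleftrightarrow> x = ?z [^] (Suc (2*k)) \<otimes> s"
  proof -
    have "?z [^] k \<otimes> (?z \<otimes> (s \<otimes> inv (?z [^] k))) = ?z [^] k \<otimes> (?z \<otimes> ?z [^] k) \<otimes> s"
      unfolding gen_conj_pow[OF assms(1,2)] using assms z by (simp add: m_assoc)
    also have "?z [^] k \<otimes> (?z \<otimes> ?z [^] k) = ?z [^] (Suc (2*k))"
      unfolding nat_pow_Suc2[OF z, symmetric] nat_pow_mult[OF z] by (simp add: mult_2)
    finally show ?thesis by simp
  qed
  finally have 2: "s \<otimes> ?y \<otimes> s = t \<longleftrightarrow> x = ?z [^] (Suc (2*k)) \<otimes> s" .
  have "refl_parity (concat (replicate (Suc k) [s, t])) x \<longleftrightarrow>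
      (refl_parity ?u x \<noteq> ((?y = s) \<noteq> (s \<otimes> ?y \<otimes> s = t)))"
    unfolding concat_replicate_Suc_right using refl_parity_append[OF u, of "[s, t]" x] assms
    by (simp add: word_prod_alternating)
  then show ?case unfolding Suc 1 2 by (simp add: mult_2_right)
qed simp

text \<open>With m the order of st, the 2m reflections (st)^i s of the relator repeat with period m,
  so each is counted an even number of times. For infinite order \<open>ord\<close> is 0 and the
  word is empty.\<close>

lemma refl_parity_relator:
  assumes "s \<in> S" "t \<in> S" "x \<in> carrier W"
  shows "\<not> refl_parity (concat (replicate (ord (s \<otimes> t)) [s, t])) x"
proof -
  let ?z = "s \<otimes> t" let ?m = "ord ?z"
  define f where "f i = (of_bool (x = ?z [^] i \<otimes> s) :: nat)" for i :: nat
  have z: "?z \<in> carrier W" using assms by simp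
  have per: "f (?m + i) = f i" for i
    using z by (simp add: f_def nat_pow_mult[symmetric] pow_ord_eq_1)
  have "(\<Sum>i<?m + n. f i) = (\<Sum>i<?m. f i) + (\<Sum>i<n. f (?m + i))" for n
    by (induction n) auto
  from this[of ?m] have "(\<Sum>i<2*?m. f i) = 2 * (\<Sum>i<?m. f i)" by (simp add: per mult_2)
  then show ?thesis unfolding refl_parity_alternating[OF assms] f_def by simp
qed

text \<open>Invariance under the defining relations makes both quantities functions of the group
  element, by \<open>presentation\<close>. The second one is the sign character.\<close>

lemma congruent_invariants:
  assumes "coxeter_congruent W S xs ys" "t \<in> carrier W"
  shows "refl_parity xs t = refl_parity ys t" "even (length xs) = even (length ys)"
  using assms
proof (induction rule: coxeter_congruent.induct)
  case (rel xs ys a b)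
  let ?r = "concat (replicate (ord (a \<otimes> b)) [a, b])"
  have r: "?r \<in> lists S" using rel alternating_in_lists by blast
  have w: "word_prod W ?r = \<one>"
    using rel by (simp add: word_prod_alternating pow_ord_eq_1)
  {
    case 1
    then show ?case
      using rel r w refl_parity_relator
      by (simp add: refl_parity_append)
  next
    case 2
    show ?case by (simp add: length_concat sum_list_replicate)
  }
qed simp_all

lemma refl_parity_cong:
  assumes "xs \<in> lists S" "ys \<in> lists S" "word_prod W xs = word_prod W ys" "t \<in> carrier W"
  shows "refl_parity xs t = refl_parity ys t"
  using congruent_invariants presentation assms by blast

lemma len_parity: "xs \<in> lists S \<Longrightarrow> even (len (word_prod W xs)) = even (length xs)"
proof -
  assume xs: "xs \<in> lists S"
  obtain ys where "ys \<in> lists S" "length ys = len (word_prod W xs)" "word_prod W ys = word_prod W xs"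
    using reduced_word xs word_prod_closed by metis
  then show ?thesis using congruent_invariants(2)[OF presentation[of ys xs]] xs by (metis one_closed)
qed

lemma len_gen_mult_neq: "s \<in> S \<Longrightarrow> u \<in> carrier W \<Longrightarrow> len (s \<otimes> u) \<noteq> len u"
proof -
  assume s: "s \<in> S" and u: "u \<in> carrier W"
  then obtain xs where xs: "xs \<in> lists S" "word_prod W xs = u"
    using carrier_iff_word by blast
  show ?thesis using len_parity[of "s # xs"] len_parity[of xs] s xs by auto
qed

section \<open>Reflections and the strong exchange condition\<close>

lemma reflE:
  assumes "t \<in> refls"
  obtains x s where "x \<in> carrier W" "s \<in> S" "t = x \<otimes> s \<otimes> inv x"
  using assms unfolding reflections_def by blast

lemma refl_closed [simp]: "t \<in> refls \<Longrightarrow> t \<in> carrier W"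
  by (auto elim!: reflE)

lemma refl_sq: "t \<in> refls \<Longrightarrow> t \<otimes> t = \<one>"
  by (auto elim!: reflE simp: m_assoc)

lemma gen_refl: "s \<in> S \<Longrightarrow> s \<in> refls"
  unfolding reflections_def by (auto intro!: exI[of _ \<one>] exI[of _ s])

lemma refl_inv: "t \<in> refls \<Longrightarrow> inv t = t"
  by (rule inv_equality) (auto simp: refl_sq)

lemma refl_conj: "t \<in> refls \<Longrightarrow> y \<in> carrier W \<Longrightarrow> y \<otimes> t \<otimes> inv y \<in> refls"
proof -
  assume "t \<in> refls" and y: "y \<in> carrier W"
  then obtain x s where x: "x \<in> carrier W" "s \<in> S" "t = x \<otimes> s \<otimes> inv x" by (auto elim: reflE)
  then have "y \<otimes> t \<otimes> inv y = (y \<otimes> x) \<otimes> s \<otimes> inv (y \<otimes> x)"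
    using y by (simp add: m_assoc inv_mult_group)
  then show ?thesis unfolding reflections_def using x y by blast
qed

lemma refl_cancel [simp]: "t \<in> refls \<Longrightarrow> x \<in> carrier W \<Longrightarrow> t \<otimes> (t \<otimes> x) = x"
  by (simp add: m_assoc[symmetric] refl_sq)

lemma refl_conj': "t \<in> refls \<Longrightarrow> y \<in> carrier W \<Longrightarrow> inv y \<otimes> t \<otimes> y \<in> refls"
  using refl_conj[of t "inv y"] by simp

text \<open>An odd count yields an index i with t = s_1 ... s_i ... s_1, and multiplying the word by
  this t deletes its i-th letter.\<close>

lemma refl_parity_delete:
  assumes "xs \<in> lists S" "t \<in> carrier W" "refl_parity xs t"
  shows "\<exists>ys. set ys \<subseteq> set xs \<and> Suc (length ys) = length xs \<and> word_prod W ys = t \<otimes> word_prod W xs"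
  using assms
proof (induction xs arbitrary: t)
  case (Cons s xs)
  then have s: "s \<in> S" "xs \<in> lists S" by auto
  show ?case
  proof (cases "t = s")
    case True
    then show ?thesis using s by (intro exI[of _ xs]) auto
  next
    case False
    with Cons.prems have "refl_parity xs (s \<otimes> t \<otimes> s)" by simp
    with Cons.IH[of "s \<otimes> t \<otimes> s"] s Cons.prems obtain ys where
      ys: "set ys \<subseteq> set xs" "Suc (length ys) = length xs" "word_prod W ys = s \<otimes> t \<otimes> s \<otimes> word_prod W xs"
      by auto
    then show ?thesis using s Cons.prems by (intro exI[of _ "s # ys"]) (auto simp: m_assoc)
  qed
qed simp

text \<open>For t = x s x^-1 use the palindrome \<open>ys @ [s] @ rev ys\<close>. Since
  \<open>ys @ rev ys\<close> represents e, the contributions of the two halves cancel, and the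
  middle letter remains.\<close>

lemma refl_parity_self:
  assumes "t \<in> refls" "xs \<in> lists S" "word_prod W xs = t"
  shows "refl_parity xs t"
proof -
  obtain x s where x: "x \<in> carrier W" "s \<in> S" and t: "t = x \<otimes> s \<otimes> inv x"
    using assms by (auto elim: reflE)
  obtain ys where ys: "ys \<in> lists S" "word_prod W ys = x" using x carrier_iff_word by blast
  have r: "rev ys \<in> lists S" using ys by auto
  have tc: "t \<in> carrier W" using assms by simp
  have "\<not> refl_parity (ys @ rev ys) t"
    using refl_parity_cong[of "ys @ rev ys" "[]" t] ys r tc x by (simp add: word_prod_rev)
  then have 1: "refl_parity ys t = refl_parity (rev ys) s"
    using ys r tc x t by (simp add: refl_parity_append m_assoc)
  have "refl_parity (ys @ [s] @ rev ys) t \<longleftrightarrow>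
      (refl_parity ys t \<noteq> ((s = s) \<noteq> refl_parity (rev ys) s))"
    using ys r tc x t by (simp add: refl_parity_append m_assoc)
  with 1 have "refl_parity (ys @ [s] @ rev ys) t" by simp
  moreover have "word_prod W (ys @ [s] @ rev ys) = t"
    using ys r x t by (simp add: word_prod_rev m_assoc)
  ultimately show ?thesis using refl_parity_cong[of xs "ys @ [s] @ rev ys" t] assms ys r x by auto
qed

text \<open>An odd parity deletes a letter of a reduced word. An even parity is reduced to this
  case: prefixing a word for t flips the parity, because t is odd on its own words and is fixed
  under conjugation by itself.\<close>

lemma refl_parity_iff_len:
  assumes "t \<in> refls" "xs \<in> lists S"
  shows "refl_parity xs t \<longleftrightarrow> len (t \<otimes> word_prod W xs) < len (word_prod W xs)"
proof -
  have *: "len (t \<otimes> word_prod W xs) < len (word_prod W xs)"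
    if p: "refl_parity xs t" and xs: "xs \<in> lists S" for xs
  proof -
    obtain ys where ys: "ys \<in> lists S" "length ys = len (word_prod W xs)" "word_prod W ys = word_prod W xs"
      using reduced_word[OF word_prod_closed[OF xs]] by metis
    then have "refl_parity ys t" using refl_parity_cong[of xs ys t] p xs assms by auto
    from refl_parity_delete[OF ys(1) _ this] assms obtain zs where
      zs: "set zs \<subseteq> set ys" "Suc (length zs) = length ys" "word_prod W zs = t \<otimes> word_prod W ys"
      by auto
    then have "zs \<in> lists S" using ys by auto
    then show ?thesis using len_word_le[of zs] zs ys by auto
  qed
  obtain ts where ts: "ts \<in> lists S" "word_prod W ts = t"
    using assms carrier_iff_word refl_closed by blast
  have "refl_parity (ts @ xs) t \<longleftrightarrow> \<not> refl_parity xs t"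
    using refl_parity_append[of ts xs t] refl_parity_self[of t ts] ts assms
    by (simp add: refl_inv refl_sq m_assoc)
  then have "\<not> refl_parity xs t \<Longrightarrow> len (word_prod W xs) < len (t \<otimes> word_prod W xs)"
    using *[of "ts @ xs"] ts assms by simp
  then show ?thesis using *[OF _ assms(2)] by (cases "refl_parity xs t") auto
qed

text \<open>The cocycle identity read through lengths. It does not ask the product u v to be
  reduced, which makes it the form of strong exchange used in later length comparisons.\<close>

lemma exchange_iff:
  assumes "t \<in> refls" "u \<in> carrier W" "v \<in> carrier W"
  shows "len (t \<otimes> (u \<otimes> v)) < len (u \<otimes> v) \<longleftrightarrow>
    (len (t \<otimes> u) < len u) \<noteq> (len (inv u \<otimes> t \<otimes> u \<otimes> v) < len v)"
proof -
  obtain xs ys where *: "xs \<in> lists S" "word_prod W xs = u" "ys \<in> lists S" "word_prod W ys = v"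
    using assms carrier_iff_word by blast
  have "refl_parity (xs @ ys) t \<longleftrightarrow> (refl_parity xs t \<noteq> refl_parity ys (inv u \<otimes> t \<otimes> u))"
    using refl_parity_append[of xs ys t] * assms by simp
  then show ?thesis
    using refl_parity_iff_len[of t "xs @ ys"] refl_parity_iff_len[of t xs]
      refl_parity_iff_len[of "inv u \<otimes> t \<otimes> u" ys] * assms refl_conj' by simp
qed

lemma len_mult_refl: "t \<in> refls \<Longrightarrow> x \<in> carrier W \<Longrightarrow> len (x \<otimes> t) = len (t \<otimes> inv x)"
  using len_inv[of "x \<otimes> t"] by (simp add: inv_mult_group refl_inv)

lemma exchange_right_iff:
  assumes "t \<in> refls" "u \<in> carrier W" "v \<in> carrier W"
  shows "len (u \<otimes> v \<otimes> t) < len (u \<otimes> v) \<longleftrightarrow>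
    (len (v \<otimes> t) < len v) \<noteq> (len (u \<otimes> (v \<otimes> t \<otimes> inv v)) < len u)"
proof -
  have t: "t \<in> carrier W" using assms by simp
  have 1: "len (u \<otimes> v \<otimes> t) = len (t \<otimes> (inv v \<otimes> inv u))"
    using len_mult_refl[of t "u \<otimes> v"] assms by (simp add: inv_mult_group)
  have 2: "len (u \<otimes> v) = len (inv v \<otimes> inv u)"
    using len_inv[of "u \<otimes> v"] assms by (simp add: inv_mult_group)
  have 3: "len (u \<otimes> (v \<otimes> t \<otimes> inv v)) = len (v \<otimes> t \<otimes> inv v \<otimes> inv u)"
    using len_mult_refl[OF refl_conj[of t v] assms(2)] assms by simp
  show ?thesis
    using exchange_iff[of t "inv v" "inv u"] assms
    unfolding 1 2 3 by (simp add: len_mult_refl)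
qed

section \<open>Parabolic subgroups\<close>

lemma len_mult_gen: "s \<in> S \<Longrightarrow> u \<in> carrier W \<Longrightarrow> len (u \<otimes> s) = len (s \<otimes> inv u)"
  by (rule len_mult_refl[OF gen_refl])

lemma gen_left_cases:
  assumes "s \<in> S" "u \<in> carrier W"
  obtains (up) "len (s \<otimes> u) = Suc (len u)" | (down) "len u = Suc (len (s \<otimes> u))"
proof -
  have "len (s \<otimes> u) \<le> Suc (len u)" using len_mult_le[of s u] assms by (simp add: len_gen)
  moreover have "len u \<le> Suc (len (s \<otimes> u))"
    using len_mult_le[of s "s \<otimes> u"] assms by (simp add: len_gen)
  ultimately show ?thesis using len_gen_mult_neq[OF assms] up down by linarith
qed

lemma gen_right_cases:
  assumes "s \<in> S" "u \<in> carrier W"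
  obtains (up) "len (u \<otimes> s) = Suc (len u)" | (down) "len u = Suc (len (u \<otimes> s))"
  using gen_left_cases[OF assms(1) inv_closed[OF assms(2)]] assms by (metis len_mult_gen len_inv)

lemma gen_mult_shorter_iff:
  assumes "s \<in> S" "t \<in> refls"
  shows "len (s \<otimes> t) < len s \<longleftrightarrow> t = s"
proof
  assume "len (s \<otimes> t) < len s"
  then have "s \<otimes> t = \<one>" using assms len_eq_0_iff[of "s \<otimes> t"] by (simp add: len_gen)
  then have "s \<otimes> (s \<otimes> t) = s" using assms by simp
  then show "t = s" using assms by (simp only: gen_cancel refl_closed)
qed (use assms in \<open>simp add: len_gen gen_sq\<close>)

text \<open>Exchange only deletes letters, so a word over J can be made reduced without leaving
  J.\<close>

lemma para_reduced_word:
  assumes J: "J \<subseteq> S" and u: "u \<in> para J"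
  obtains xs where "xs \<in> lists J" "length xs = len u" "word_prod W xs = u"
proof -
  have "\<exists>ys \<in> lists J. length ys = len (word_prod W xs) \<and> word_prod W ys = word_prod W xs"
    if "xs \<in> lists J" for xs
    using that
  proof (induction xs)
    case (Cons s xs)
    then obtain ys where ys: "ys \<in> lists J" "length ys = len (word_prod W xs)"
      "word_prod W ys = word_prod W xs" by auto
    have s: "s \<in> J" "s \<in> S" using Cons J by auto
    have ysS: "ys \<in> lists S" using ys J by auto
    have c: "word_prod W ys \<in> carrier W" using ysS by simp
    from s(2) c show ?case
    proof (cases rule: gen_left_cases)
      case up
      then show ?thesis using ys s by (intro bexI[of _ "s # ys"]) auto
    next
      case down
      then have "refl_parity ys s"
        using refl_parity_iff_len[OF gen_refl[OF s(2)] ysS] by simp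
      from refl_parity_delete[OF ysS _ this] s obtain zs where zs: "set zs \<subseteq> set ys"
        "Suc (length zs) = length ys" "word_prod W zs = s \<otimes> word_prod W ys" by auto
      then show ?thesis using ys down by (intro bexI[of _ zs]) auto
    qed
  qed auto
  moreover obtain xs where "xs \<in> lists J" "word_prod W xs = u"
    using para_iff_word[OF J] u by blast
  ultimately show ?thesis using that by metis
qed

text \<open>Multiplying by t deletes a letter from a word over J, so t u lies in W_J along with
  u.\<close>

lemma para_refl_left:
  assumes J: "J \<subseteq> S" and u: "u \<in> para J" and t: "t \<in> refls" "len (t \<otimes> u) < len u"
  shows "t \<in> para J"
proof -
  obtain xs where xs: "xs \<in> lists J" "word_prod W xs = u"
    using para_iff_word[OF J] u by blast
  have xsS: "xs \<in> lists S" using xs J by auto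
  have "refl_parity xs t" using refl_parity_iff_len[OF t(1) xsS] xs t by simp
  from refl_parity_delete[OF xsS _ this] t obtain ys where
    "set ys \<subseteq> set xs" "word_prod W ys = t \<otimes> u" using xs by auto
  then have "t \<otimes> u \<in> para J" using para_iff_word[OF J] xs by blast
  then have "(t \<otimes> u) \<otimes> inv u \<in> para J" using para_inv[OF J u] para_mult by blast
  then show ?thesis using t para_closed[OF J u] by (simp add: m_assoc)
qed

lemma para_refl_right:
  assumes J: "J \<subseteq> S" and u: "u \<in> para J" and t: "t \<in> refls" "len (u \<otimes> t) < len u"
  shows "t \<in> para J"
  using para_refl_left[OF J para_inv[OF J u] t(1)] t para_closed[OF J u]
  by (simp add: len_mult_refl)

lemma para_gen_iff:
  assumes J: "J \<subseteq> S" and r: "r \<in> S"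
  shows "r \<in> para J \<longleftrightarrow> r \<in> J"
proof
  assume "r \<in> para J"
  from para_reduced_word[OF J this] obtain xs
    where xs: "xs \<in> lists J" "length xs = len r" "word_prod W xs = r" .
  then have "length xs = 1" using r by (simp add: len_gen)
  then obtain j where "xs = [j]" by (cases xs) auto
  then show "r \<in> J" using xs J by auto
qed (rule para_gen)

lemma para_descent_right:
  assumes J: "J \<subseteq> S" and u: "u \<in> para J" "u \<noteq> \<one>"
  obtains j where "j \<in> J" "len u = Suc (len (u \<otimes> j))" "u \<otimes> j \<in> para J"
proof -
  from para_reduced_word[OF J u(1)] obtain xs
    where xs: "xs \<in> lists J" "length xs = len u" "word_prod W xs = u" .
  with u obtain ys j where e: "xs = ys @ [j]" by (cases xs rule: rev_cases) auto
  have j: "j \<in> J" "ys \<in> lists J" "j \<in> S" "ys \<in> lists S" using e xs J by auto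
  then have ysc: "word_prod W ys \<in> carrier W" by simp
  from j e xs(3) have "u = word_prod W ys \<otimes> j" by simp
  then have uj: "u \<otimes> j = word_prod W ys" using j(3) ysc by (simp only: gen_cancel_right)
  have uc: "u \<in> carrier W" using u para_closed[OF J] by blast
  have "len (u \<otimes> j) \<le> length ys" unfolding uj using j by (intro len_word_le)
  also have "\<dots> < len u" using xs e by simp
  finally have "len u = Suc (len (u \<otimes> j))" using gen_right_cases[OF j(3) uc] by force
  moreover have "u \<otimes> j \<in> para J" unfolding uj para_iff_word[OF J] using j by blast
  ultimately show ?thesis using that j by blast
qed

lemma carrier_descent_right:
  assumes "u \<in> carrier W" "u \<noteq> \<one>"
  obtains j where "j \<in> S" "len u = Suc (len (u \<otimes> j))"
proof -
  have "u \<in> para S" using assms gens_generate by simp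
  from para_descent_right[OF order.refl this assms(2)] show ?thesis using that by metis
qed

section \<open>Minimal coset representatives\<close>

lemma min_right_iff:
  assumes "J \<subseteq> S"
  shows "u \<in> min_right W S J \<longleftrightarrow> u \<in> carrier W \<and> (\<forall>j \<in> J. len (u \<otimes> j) = Suc (len u))"
proof -
  have "\<not> len (u \<otimes> j) < len u \<longleftrightarrow> len (u \<otimes> j) = Suc (len u)" if "u \<in> carrier W" "j \<in> S" for j
    using that(2,1) by (cases rule: gen_right_cases) auto
  then show ?thesis
    unfolding min_right_def right_descents_def using assms by blast
qed

lemma min_right_closed [simp]: "u \<in> min_right W S J \<Longrightarrow> u \<in> carrier W"
  by (simp add: min_right_def)

lemma min_left_iff_inv:
  assumes "J \<subseteq> S"
  shows "u \<in> min_left W S J \<longleftrightarrow> u \<in> carrier W \<and> inv u \<in> min_right W S J"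
  using assms len_mult_gen[of _ "inv u"] unfolding min_right_def min_left_def right_descents_def left_descents_def
  by (auto simp: subset_iff)

lemma min_left_closed [simp]: "u \<in> min_left W S J \<Longrightarrow> u \<in> carrier W"
  by (simp add: min_left_def)

lemma min_left_iff:
  assumes "J \<subseteq> S"
  shows "u \<in> min_left W S J \<longleftrightarrow> u \<in> carrier W \<and> (\<forall>j \<in> J. len (j \<otimes> u) = Suc (len u))"
  using assms by (auto simp: min_left_iff_inv min_right_iff len_mult_gen subset_iff)

text \<open>Suppose j lengthens y but shortens v y. Exchange then makes y j y^-1 shorten v; this
  conjugate lies in W_J, against the minimality of v.\<close>

lemma len_mult_para_of_minimal:
  assumes J: "J \<subseteq> S" and v: "v \<in> carrier W" and min: "\<And>y. y \<in> para J \<Longrightarrow> len v \<le> len (v \<otimes> y)"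
    and "x \<in> para J"
  shows "len (v \<otimes> x) = len v + len x"
  using assms(4)
proof (induction "len x" arbitrary: x)
  case 0
  then show ?case using v len_eq_0_iff[of x] para_closed[OF J] by force
next
  case (Suc n)
  then have "x \<noteq> \<one>" by auto
  from para_descent_right[OF J Suc.prems this] obtain j
    where j: "j \<in> J" "len x = Suc (len (x \<otimes> j))" "x \<otimes> j \<in> para J" .
  let ?y = "x \<otimes> j"
  have jS: "j \<in> S" using j J by auto
  have x: "x \<in> carrier W" "x = ?y \<otimes> j" using para_closed[OF J Suc.prems] jS by auto
  have yc: "?y \<in> carrier W" using x jS by simp
  have IH: "len (v \<otimes> ?y) = len v + len ?y" using Suc j by auto
  have t: "?y \<otimes> j \<otimes> inv ?y \<in> para J"
    by (intro para_mult para_inv[OF J] j para_gen)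
  have "\<not> len (v \<otimes> ?y \<otimes> j) < len (v \<otimes> ?y)"
    using exchange_right_iff[OF gen_refl[OF jS] v yc] min[OF t] x j by auto
  then have "len (v \<otimes> ?y \<otimes> j) = Suc (len (v \<otimes> ?y))"
    using gen_right_cases[OF jS, of "v \<otimes> ?y"] v yc by force
  then show ?case using IH j v x jS yc by (simp add: m_assoc)
qed

lemma minimal_in_coset:
  assumes J: "J \<subseteq> S" and u: "u \<in> carrier W"
  obtains v x where "v \<in> carrier W" "x \<in> para J" "u = v \<otimes> x"
    "\<And>y. y \<in> para J \<Longrightarrow> len (v \<otimes> y) = len v + len y"
proof -
  obtain x where x: "x \<in> para J" "\<And>y. y \<in> para J \<Longrightarrow> len (u \<otimes> x) \<le> len (u \<otimes> y)"
    using arg_min_nat_lemma[of "\<lambda>x. x \<in> para J" \<one> "\<lambda>x. len (u \<otimes> x)"] para_one by blast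
  have xc: "x \<in> carrier W" using x para_closed[OF J] by blast
  have "len (u \<otimes> x) \<le> len (u \<otimes> x \<otimes> y)" if "y \<in> para J" for y
    using x(2)[OF para_mult[OF x(1) that]] u xc para_closed[OF J that] by (simp add: m_assoc)
  then have "len (u \<otimes> x \<otimes> y) = len (u \<otimes> x) + len y" if "y \<in> para J" for y
    using len_mult_para_of_minimal[OF J] that u xc by simp
  then show ?thesis using that[of "u \<otimes> x" "inv x"] u xc para_inv[OF J x(1)] by (simp add: m_assoc)
qed

lemma len_min_right_mult:
  assumes J: "J \<subseteq> S" and v: "v \<in> min_right W S J" and x: "x \<in> para J"
  shows "len (v \<otimes> x) = len v + len x"
proof -
  obtain v0 y where v0: "v0 \<in> carrier W" "y \<in> para J" "v = v0 \<otimes> y"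
    and add: "\<And>y. y \<in> para J \<Longrightarrow> len (v0 \<otimes> y) = len v0 + len y"
    using minimal_in_coset[OF J min_right_closed[OF v]] by metis
  have "y = \<one>"
  proof (rule ccontr)
    assume "y \<noteq> \<one>"
    from para_descent_right[OF J v0(2) this] obtain j
      where j: "j \<in> J" "len y = Suc (len (y \<otimes> j))" "y \<otimes> j \<in> para J" .
    have yc: "y \<in> carrier W" "j \<in> carrier W" using v0 j J para_closed[OF J] by auto
    have "len (v \<otimes> j) < len v"
      using add[OF j(3)] add[OF v0(2)] j v0 yc by (simp add: m_assoc)
    then show False using v j unfolding min_right_iff[OF J] by auto
  qed
  then show ?thesis using v0 add[OF x] by simp
qed

lemma min_right_factor:
  assumes J: "J \<subseteq> S" and u: "u \<in> carrier W"
  obtains v x where "v \<in> min_right W S J" "x \<in> para J" "u = v \<otimes> x" "len u = len v + len x"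
proof -
  obtain v x where v: "v \<in> carrier W" "x \<in> para J" "u = v \<otimes> x"
    and add: "\<And>y. y \<in> para J \<Longrightarrow> len (v \<otimes> y) = len v + len y"
    using minimal_in_coset[OF J u] by metis
  have "v \<in> min_right W S J"
    unfolding min_right_iff[OF J] using v add[OF para_gen] J by (auto simp: len_gen subset_iff)
  then show ?thesis using that v add by blast
qed

lemma min_right_unique:
  assumes J: "J \<subseteq> S" and v: "v \<in> min_right W S J" "v' \<in> min_right W S J"
    and x: "x \<in> para J" "x' \<in> para J" and e: "v \<otimes> x = v' \<otimes> x'"
  shows "v = v' \<and> x = x'"
proof -
  have c: "v \<in> carrier W" "v' \<in> carrier W" "x \<in> carrier W" "x' \<in> carrier W"
    using v x para_closed[OF J] by auto
  let ?y = "x \<otimes> inv x'"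
  have y: "?y \<in> para J" "inv ?y \<in> para J" using x para_inv[OF J] para_mult by auto
  have v': "v' = v \<otimes> ?y"
    using e c by (simp add: m_assoc[symmetric]) (simp add: m_assoc)
  moreover have "v = v' \<otimes> inv ?y" unfolding v' using c by (simp add: m_assoc)
  ultimately have "len v' = len v + len ?y" "len v = len v' + len (inv ?y)"
    using len_min_right_mult[OF J v(1) y(1)] len_min_right_mult[OF J v(2) y(2)] by metis+
  then have "?y = \<one>" using len_eq_0_iff[of ?y] c by simp
  then have "v = v'" using v' c by simp
  then show ?thesis using e c by simp
qed

text \<open>Deodhar's lemma. If rv is not minimal, some j in J shortens it although j lengthens v.
  Exchange then makes the reflection v^-1 r v shorten j, and a reflection shortening a generator
  equals it.\<close>

lemma min_right_gen_cases:
  assumes J: "J \<subseteq> S" and v: "v \<in> min_right W S J" and r: "r \<in> S"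
  obtains (min) "r \<otimes> v \<in> min_right W S J" | (fixed) j where "j \<in> J" "r \<otimes> v = v \<otimes> j"
proof (cases "r \<otimes> v \<in> min_right W S J")
  case False
  have vc: "v \<in> carrier W" using v by simp
  from False obtain j where j: "j \<in> J" and ne: "len (r \<otimes> v \<otimes> j) \<noteq> Suc (len (r \<otimes> v))"
    unfolding min_right_iff[OF J] using vc r by auto
  have jS: "j \<in> S" using j J by auto
  have d: "len (r \<otimes> v) = Suc (len (r \<otimes> v \<otimes> j))"
    using ne gen_right_cases[OF jS, of "r \<otimes> v"] vc r by force
  have vj: "len (v \<otimes> j) = Suc (len v)" using v j unfolding min_right_iff[OF J] by auto
  have "len (r \<otimes> v \<otimes> j) < len (v \<otimes> j)"
    using r vc by (rule gen_left_cases) (use d vj in auto)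
  moreover have "len (v \<otimes> j) \<le> Suc (len (r \<otimes> v \<otimes> j))"
    using len_mult_le[of r "r \<otimes> v \<otimes> j"] vc r jS by (simp add: m_assoc len_gen)
  then have "len v < len (r \<otimes> v)" using d vj by simp
  ultimately have up: "len v < len (r \<otimes> v)" "len (r \<otimes> (v \<otimes> j)) < len (v \<otimes> j)"
    using vc r jS by (auto simp: m_assoc)
  have "len (inv v \<otimes> r \<otimes> v \<otimes> j) < len j"
    using exchange_iff[OF gen_refl[OF r] vc gen_closed[OF jS]] up by auto
  then have "len (inv v \<otimes> r \<otimes> v \<otimes> j) = 0" using jS by (simp add: len_gen)
  then have "inv v \<otimes> r \<otimes> v \<otimes> j = \<one>" using len_eq_0_iff vc r jS by simp
  then have "inv v \<otimes> r \<otimes> v = j" using inv_equality[of "inv v \<otimes> r \<otimes> v" j] vc r jS by simp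
  then have "r \<otimes> v = v \<otimes> j" using vc r by (auto simp: m_assoc)
  then show ?thesis using fixed j by blast
qed (rule min)

lemma len_para_gen_outside:
  assumes "H \<subseteq> S" "x \<in> para H" "g \<in> S" "g \<notin> H"
  shows "len (x \<otimes> g) = Suc (len x)"
proof -
  have "\<not> len (x \<otimes> g) < len x"
    using para_refl_right[OF assms(1,2) gen_refl[OF assms(3)]] para_gen_iff[OF assms(1,3)] assms by blast
  then show ?thesis
    using gen_right_cases[OF assms(3) para_closed[OF assms(1,2)]] by force
qed

section \<open>Bruhat order\<close>

lemma ble_closed: "u \<preceq> v \<Longrightarrow> u \<in> carrier W \<and> v \<in> carrier W"
  by (simp add: bruhat_le_def)

lemma ble_refl: "u \<in> carrier W \<Longrightarrow> u \<preceq> u"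
  by (simp add: bruhat_le_def)

lemma ble_trans: "u \<preceq> v \<Longrightarrow> v \<preceq> x \<Longrightarrow> u \<preceq> x"
  by (auto simp: bruhat_le_def)

lemma ble_step: "u \<in> carrier W \<Longrightarrow> t \<in> refls \<Longrightarrow> len u < len (u \<otimes> t) \<Longrightarrow> u \<preceq> u \<otimes> t"
  by (auto simp: bruhat_le_def bruhat_step_def intro!: r_into_rtranclp)

lemma ble_induct [consumes 1, case_names base step]:
  assumes "u \<preceq> v" "u \<in> carrier W \<Longrightarrow> P u"
    "\<And>y t. \<lbrakk>u \<preceq> y; y \<in> carrier W; t \<in> refls; len y < len (y \<otimes> t); P y\<rbrakk> \<Longrightarrow> P (y \<otimes> t)"
  shows "P v"
proof -
  have u: "u \<in> carrier W" using assms ble_closed by blast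
  have "(bruhat_step W S)\<^sup>*\<^sup>* u v" using assms by (simp add: bruhat_le_def)
  then have "P v \<and> v \<in> carrier W"
  proof (induction rule: rtranclp_induct)
    case (step y z)
    then have "u \<preceq> y" using u by (simp add: bruhat_le_def)
    then show ?case using step assms(3) by (auto simp: bruhat_step_def)
  qed (use u assms in auto)
  then show ?thesis ..
qed

lemma ble_eq_or_len_less: "u \<preceq> v \<Longrightarrow> u = v \<or> len u < len v"
  by (induction rule: ble_induct) auto

lemma ble_antisym: "u \<preceq> v \<Longrightarrow> v \<preceq> u \<Longrightarrow> u = v"
  using ble_eq_or_len_less[of u v] ble_eq_or_len_less[of v u] by auto

lemma ble_inv: "u \<preceq> v \<Longrightarrow> inv u \<preceq> inv v"
proof (induction rule: ble_induct)
  case base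
  then show ?case using ble_refl by simp
next
  case (step y t)
  have "inv (y \<otimes> t) = inv y \<otimes> (y \<otimes> t \<otimes> inv y)"
    using step by (simp add: inv_mult_group refl_inv m_assoc)
  moreover have "inv y \<preceq> inv y \<otimes> (y \<otimes> t \<otimes> inv y)"
    using step by (intro ble_step refl_conj) (auto simp flip: calculation)
  ultimately show ?case using step ble_trans by simp
qed

text \<open>ys and yts differ by the reflection sts, so they are comparable; t \<noteq> s makes
  exchange preserve the direction.\<close>

lemma step_mult_gen:
  assumes "y \<in> carrier W" "t \<in> refls" "len y < len (y \<otimes> t)" "s \<in> S" "t \<noteq> s"
  shows "y \<otimes> s \<preceq> y \<otimes> t \<otimes> s"
proof -
  let ?v = "y \<otimes> t" and ?t = "s \<otimes> t \<otimes> s"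
  have c: "t \<in> carrier W" "s \<in> carrier W" using assms by auto
  have r: "?t \<in> refls" using refl_conj[OF assms(2), of s] assms by simp
  have v: "?v \<otimes> s \<otimes> s \<otimes> t = y" "?v \<otimes> s \<otimes> s = ?v" "?v \<otimes> s \<otimes> ?t = y \<otimes> s"
    using assms c by (simp_all add: m_assoc refl_sq)
  have "len (?v \<otimes> s \<otimes> ?t) < len (?v \<otimes> s)"
    using exchange_right_iff[OF assms(2), of "?v \<otimes> s" s] v gen_mult_shorter_iff[OF assms(4,2)] assms c
    by simp
  moreover have "y \<otimes> s \<otimes> ?t = ?v \<otimes> s" using assms c by (simp add: m_assoc)
  ultimately show ?thesis using ble_step[of "y \<otimes> s" ?t] assms c r v by simp
qed

text \<open>This form of the lifting property mentions no descents and so passes along a chain of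
  Bruhat steps. At a step from y to yt with t = s, an upper bound ys is already the new endpoint;
  for t \<noteq> s it is below yts.\<close>

lemma lift_up: "u \<preceq> v \<Longrightarrow> s \<in> S \<Longrightarrow> u \<otimes> s \<preceq> v \<or> u \<otimes> s \<preceq> v \<otimes> s"
proof (induction rule: ble_induct)
  case base
  then show ?case using ble_refl by simp
next
  case (step y t)
  then show ?case using ble_trans ble_step step_mult_gen by metis
qed

lemma lift_down: "u \<preceq> v \<Longrightarrow> s \<in> S \<Longrightarrow> u \<preceq> v \<otimes> s \<or> u \<otimes> s \<preceq> v \<otimes> s"
proof (induction rule: ble_induct)
  case base
  then show ?case using ble_refl by simp
next
  case (step y t)
  then show ?case using ble_trans step_mult_gen[of y t s] gen_cancel_right[of s y] by metis
qed

lemma ble_gen_up: "u \<in> carrier W \<Longrightarrow> s \<in> S \<Longrightarrow> len u < len (u \<otimes> s) \<Longrightarrow> u \<preceq> u \<otimes> s"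
  using ble_step gen_refl by blast

lemma ble_gen_down: "u \<in> carrier W \<Longrightarrow> s \<in> S \<Longrightarrow> len (u \<otimes> s) < len u \<Longrightarrow> u \<otimes> s \<preceq> u"
  using ble_gen_up[of "u \<otimes> s" s] by simp

lemma lift_descent:
  "u \<preceq> v \<Longrightarrow> s \<in> S \<Longrightarrow> len (v \<otimes> s) < len v \<Longrightarrow> u \<otimes> s \<preceq> v"
  using lift_up ble_gen_down ble_trans ble_closed by metis

lemma lift_descent_left:
  assumes "u \<preceq> v" "s \<in> S" "len (s \<otimes> v) < len v"
  shows "s \<otimes> u \<preceq> v"
proof -
  have c: "u \<in> carrier W" "v \<in> carrier W" using ble_closed assms by auto
  have "inv u \<otimes> s \<preceq> inv v"
    using lift_descent[OF ble_inv[OF assms(1)] assms(2)] assms c by (simp add: len_mult_gen)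
  from ble_inv[OF this] show ?thesis using c assms by (simp add: inv_mult_group)
qed

lemma ble_prefix:
  assumes "x \<in> carrier W" "y \<in> carrier W" "len (x \<otimes> y) = len x + len y"
  shows "x \<preceq> x \<otimes> y"
  using assms(2,3)
proof (induction "len y" arbitrary: y)
  case 0
  then show ?case using len_eq_0_iff[of y] assms ble_refl by simp
next
  case (Suc n)
  then have "y \<noteq> \<one>" by auto
  from carrier_descent_right[OF Suc.prems(1) this] obtain j
    where j: "j \<in> S" "len y = Suc (len (y \<otimes> j))" .
  have e: "x \<otimes> y \<otimes> j = x \<otimes> (y \<otimes> j)" "x \<otimes> (y \<otimes> j) \<otimes> j = x \<otimes> y"
    using assms Suc j by (simp_all add: m_assoc gen_sq)
  have "len (x \<otimes> y) \<le> Suc (len (x \<otimes> (y \<otimes> j)))"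
    using len_mult_le[of "x \<otimes> (y \<otimes> j)" j] e assms Suc j by (simp add: len_gen)
  then have l: "len (x \<otimes> (y \<otimes> j)) = len x + len (y \<otimes> j)"
    using len_mult_le[of x "y \<otimes> j"] assms Suc.prems j by simp
  then have "x \<preceq> x \<otimes> (y \<otimes> j)" using Suc j by auto
  moreover have "x \<otimes> (y \<otimes> j) \<preceq> x \<otimes> y"
    using ble_gen_up[of "x \<otimes> (y \<otimes> j)" j] e l assms Suc.prems j by simp
  ultimately show ?case by (rule ble_trans)
qed

lemma ble_suffix:
  assumes "x \<in> carrier W" "y \<in> carrier W" "len (x \<otimes> y) = len x + len y"
  shows "y \<preceq> x \<otimes> y"
proof -
  have "inv y \<preceq> inv y \<otimes> inv x"
    using assms len_inv[of "x \<otimes> y"] by (intro ble_prefix) (auto simp: inv_mult_group)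
  from ble_inv[OF this] show ?thesis using assms by (simp add: inv_mult_group)
qed

lemma ble_one: "u \<in> carrier W \<Longrightarrow> \<one> \<preceq> u"
  using ble_prefix[of \<one> u] by simp

lemma para_down:
  assumes J: "J \<subseteq> S" and "u \<preceq> v" "v \<in> para J"
  shows "u \<in> para J"
proof -
  have "v \<in> para J \<longrightarrow> u \<in> para J"
    using assms(2)
  proof (induction rule: ble_induct)
    case (step y t)
    have "y \<in> para J" if v: "y \<otimes> t \<in> para J"
    proof -
      have e: "y \<otimes> t \<otimes> t = y" using step by (simp add: m_assoc refl_sq)
      have "t \<in> para J" using para_refl_right[OF J v step(3)] step e by simp
      then show ?thesis using para_mult[OF v] e by force
    qed
    then show ?case using step by blast
  qed simp
  then show ?thesis using assms by simp
qed

section \<open>Supports, and the maximum of [e,w] \<inter> W_H\<close>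

lemma supp_subset: "supp W S u \<subseteq> S"
  by (auto simp: supp_def)

lemma para_supp: "u \<in> carrier W \<Longrightarrow> u \<in> para (supp W S u)"
proof (induction "len u" arbitrary: u)
  case 0
  then show ?case using len_eq_0_iff[of u] para_one by simp
next
  case (Suc n)
  then have "u \<noteq> \<one>" by auto
  from carrier_descent_right[OF Suc.prems this] obtain j
    where j: "j \<in> S" "len u = Suc (len (u \<otimes> j))" .
  have e: "u \<otimes> j \<otimes> j = u" using Suc j by simp
  then have l: "len (u \<otimes> j \<otimes> j) = len (u \<otimes> j) + len j" using j by (simp add: len_gen)
  have "j \<preceq> u" "u \<otimes> j \<preceq> u"
    using ble_suffix[OF _ _ l] ble_prefix[OF _ _ l] Suc.prems j e by auto
  then have s: "j \<in> supp W S u" "supp W S (u \<otimes> j) \<subseteq> supp W S u"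
    using j ble_trans by (auto simp: supp_def)
  have "u \<otimes> j \<in> para (supp W S (u \<otimes> j))" using Suc j by auto
  then have "u \<otimes> j \<in> para (supp W S u)" using para_mono[OF s(2)] by blast
  from para_mult[OF this para_gen[OF s(1)]] show ?case using e by simp
qed

lemma para_iff_supp:
  assumes "J \<subseteq> S" "u \<in> carrier W"
  shows "u \<in> para J \<longleftrightarrow> supp W S u \<subseteq> J"
proof
  assume u: "u \<in> para J"
  show "supp W S u \<subseteq> J"
    using para_down[OF assms(1) _ u] para_gen_iff[OF assms(1)] by (auto simp: supp_def)
next
  assume "supp W S u \<subseteq> J"
  then show "u \<in> para J" using para_mono para_supp assms by blast
qed

text \<open>Membership in a parabolic subgroup is a condition on the support alone, so intersecting
  subgroups amounts to intersecting generating sets.\<close>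

lemma para_Int:
  assumes "J \<subseteq> S" "K \<subseteq> S" "u \<in> para J" "u \<in> para K"
  shows "u \<in> para (J \<inter> K)"
  using assms para_iff_supp[of J u] para_iff_supp[of K u] para_iff_supp[of "J \<inter> K" u] para_closed
  by blast

text \<open>Induction along a right descent j of w, with m the maximum for wj. If j is not in H it
  lengthens every y in W_H, so lifting puts y below wj and m stays the maximum. If j is in H, the
  longer of m and mj is the maximum.\<close>

lemma parabolic_maximum:
  assumes H: "H \<subseteq> S" and "w \<in> carrier W"
  shows "\<exists>m \<in> para H. m \<preceq> w \<and> (\<forall>y \<in> para H. y \<preceq> w \<longrightarrow> y \<preceq> m)"
  using assms(2)
proof (induction "len w" arbitrary: w)
  case 0
  then have "w = \<one>" using len_eq_0_iff[of w] by simp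
  then show ?case using para_one ble_refl by blast
next
  case (Suc n)
  then have "w \<noteq> \<one>" by auto
  from carrier_descent_right[OF Suc.prems this] obtain j
    where j: "j \<in> S" "len w = Suc (len (w \<otimes> j))" .
  have wj: "w \<otimes> j \<preceq> w" using ble_gen_down Suc.prems j by simp
  from Suc j have "\<exists>m \<in> para H. m \<preceq> w \<otimes> j \<and> (\<forall>y \<in> para H. y \<preceq> w \<otimes> j \<longrightarrow> y \<preceq> m)" by simp
  then obtain m where m: "m \<in> para H" "m \<preceq> w \<otimes> j"
    and max: "\<And>y. y \<in> para H \<Longrightarrow> y \<preceq> w \<otimes> j \<Longrightarrow> y \<preceq> m" by blast
  have mc: "m \<in> carrier W" using m ble_closed by blast
  show ?case
  proof (cases "j \<in> H")
    case False
    have "y \<preceq> m" if y: "y \<in> para H" "y \<preceq> w" for y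
    proof -
      have "y \<preceq> y \<otimes> j"
        using len_para_gen_outside[OF H y(1) j(1) False] ble_gen_up j y ble_closed by simp
      then show ?thesis using lift_down[OF y(2) j(1)] max[OF y(1)] ble_trans by blast
    qed
    then show ?thesis using m ble_trans wj by blast
  next
    case True
    have mj: "m \<otimes> j \<in> para H" using para_mult m para_gen True by blast
    have mw: "m \<preceq> w" using m wj ble_trans by blast
    then have mjw: "m \<otimes> j \<preceq> w" using lift_descent j by simp
    have y: "y \<preceq> m \<or> y \<preceq> m \<otimes> j" if y: "y \<in> para H" "y \<preceq> w" for y
    proof -
      have yj: "y \<otimes> j \<in> para H" "y \<otimes> j \<otimes> j = y"
        using para_mult y para_gen True j ble_closed by auto
      show ?thesis
        using lift_down[OF y(2) j(1)] max[OF y(1)] max[OF yj(1)] lift_up[of "y \<otimes> j" m j] yj j by auto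
    qed
    show ?thesis
    proof (cases "len m < len (m \<otimes> j)")
      case True
      then show ?thesis using y mj mjw ble_gen_up[OF mc j(1)] ble_trans by blast
    next
      case False
      then have "m \<otimes> j \<preceq> m"
        using gen_right_cases[OF j(1) mc] ble_gen_down[OF mc j(1)] by force
      then show ?thesis using y m mw ble_trans by blast
    qed
  qed
qed

lemma max_parabolic:
  assumes "H \<subseteq> S" "w \<in> carrier W"
  shows "max_parabolic W S H w \<in> para H" "max_parabolic W S H w \<preceq> w"
    "\<And>y. y \<in> para H \<Longrightarrow> y \<preceq> w \<Longrightarrow> y \<preceq> max_parabolic W S H w"
proof -
  obtain m where m: "m \<in> para H" "m \<preceq> w" "\<And>y. y \<in> para H \<Longrightarrow> y \<preceq> w \<Longrightarrow> y \<preceq> m"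
    using parabolic_maximum[OF assms] by blast
  have "max_parabolic W S H w = m"
    unfolding max_parabolic_def lower_interval_def
    by (rule the_equality) (use m ble_antisym in blast)+
  then show "max_parabolic W S H w \<in> para H" "max_parabolic W S H w \<preceq> w"
    "\<And>y. y \<in> para H \<Longrightarrow> y \<preceq> w \<Longrightarrow> y \<preceq> max_parabolic W S H w" using m by auto
qed

end

section \<open>Factorizations relative to a system\<close>

text \<open>The conditions are symmetric under inversion with J and K exchanged, which
  \<open>dual\<close> exploits. This is why K is a parameter on a par with J and why the domain of M
  is given by an element \<open>w\<^sub>0\<close> of W_H. \<open>H_form\<close> is extracted from
  [S0] by \<open>commuting_pair_matching\<close>.\<close>

locale matching_system = coxeter_system +
  fixes J K H :: "'a set" and M :: "'a \<Rightarrow> 'a" and s w\<^sub>0 :: 'a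
  assumes JS: "J \<subseteq> S" and KS: "K \<subseteq> S" and sS: "s \<in> S"
    and JK: "J \<inter> K = commuting_gens W S s"
    and H_cover: "H \<subseteq> J \<union> K"
    and H_form: "H = {s} \<or> (\<exists>t. H = {s, t} \<and> s \<otimes> t \<noteq> t \<otimes> s)"
    and M_one: "M \<one> = s"
    and w0_para: "w\<^sub>0 \<in> para H"
    and M_closed: "x \<preceq> w\<^sub>0 \<Longrightarrow> M x \<preceq> w\<^sub>0"
    and M_invol: "x \<preceq> w\<^sub>0 \<Longrightarrow> M (M x) = x"
begin

definition left_commuting :: "'a set \<Rightarrow> bool" where
  "left_commuting A \<longleftrightarrow> A \<subseteq> H \<and> card A \<le> 1 \<and> (\<forall>\<alpha> \<in> A. commutes_with_left W S w\<^sub>0 M \<alpha>)"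

definition right_commuting :: "'a set \<Rightarrow> bool" where
  "right_commuting B \<longleftrightarrow> B \<subseteq> H \<and> card B \<le> 1 \<and> (\<forall>\<beta> \<in> B. commutes_with_right W S w\<^sub>0 M \<beta>)"

text \<open>Unlike in an \<open>\<S>\<close>-factorization, \<open>a\<close> and \<open>c\<close> need not be minimal coset representatives;
  \<open>A\<close> and \<open>B\<close> bound their supports within \<open>H\<close>.\<close>

definition loose_fact :: "'a set \<Rightarrow> 'a set \<Rightarrow> 'a \<Rightarrow> 'a \<Rightarrow> 'a \<Rightarrow> bool" where
  "loose_fact A B a b c \<longleftrightarrow> left_commuting A \<and> right_commuting B \<and>
     a \<in> para (K - (H - A)) \<and> b \<in> para H \<and> b \<preceq> w\<^sub>0 \<and> c \<in> para (J - (H - B)) \<and>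
     len (a \<otimes> b \<otimes> c) = len a + len b + len c"

text \<open>A relation, because the value depends a priori on the factorization chosen;
  \<open>realizes_unique\<close> shows that u determines v.\<close>

definition realizes :: "'a set \<Rightarrow> 'a set \<Rightarrow> 'a \<Rightarrow> 'a \<Rightarrow> bool" where
  "realizes A B u v \<longleftrightarrow>
     (\<exists>a b c. loose_fact A B a b c \<and> u = a \<otimes> b \<otimes> c \<and> v = a \<otimes> M b \<otimes> c)"

lemma HS: "H \<subseteq> S" using JS KS H_cover by blast

lemma sH: "s \<in> H" using H_form by auto

lemma commuting: "g \<in> J \<inter> K \<Longrightarrow> g \<in> S \<and> g \<otimes> s = s \<otimes> g"
  unfolding JK by (auto simp: commuting_gens_def)

lemma sJK: "s \<in> J" "s \<in> K"
  using JK sS by (auto simp: commuting_gens_def)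

text \<open>A second element of H does not commute with s, so it lies outside J \<inter> K.\<close>

lemma H_side: "(H \<subseteq> K \<and> H \<inter> J = {s}) \<or> (H \<subseteq> J \<and> H \<inter> K = {s})"
  using H_form
proof
  assume "\<exists>t. H = {s, t} \<and> s \<otimes> t \<noteq> t \<otimes> s"
  then obtain t where t: "H = {s, t}" "s \<otimes> t \<noteq> t \<otimes> s" by blast
  then have "t \<notin> J \<inter> K" using commuting by metis
  then show ?thesis using t sJK H_cover by blast
qed (use sJK in auto)

lemma below_w0: "x \<preceq> w\<^sub>0 \<Longrightarrow> x \<in> para H \<and> x \<in> carrier W"
  using para_down[OF HS _ w0_para] ble_closed by blast

lemma below_M: "x \<preceq> w\<^sub>0 \<Longrightarrow> M x \<in> para H \<and> M x \<in> carrier W"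
  using below_w0 M_closed by blast

lemma one_below: "\<one> \<preceq> w\<^sub>0"
  using ble_one para_closed[OF HS w0_para] by simp

lemma s_below: "s \<preceq> w\<^sub>0" "M s = \<one>"
  using M_closed[OF one_below] M_invol[OF one_below] M_one by auto

lemma left_commutingD:
  assumes "left_commuting A" "\<alpha> \<in> A"
  shows "\<alpha> \<in> H" "\<alpha> \<in> S" "x \<preceq> w\<^sub>0 \<Longrightarrow> \<alpha> \<otimes> x \<preceq> w\<^sub>0" "x \<preceq> w\<^sub>0 \<Longrightarrow> M (\<alpha> \<otimes> x) = \<alpha> \<otimes> M x"
proof -
  have "commutes_with_left W S w\<^sub>0 M \<alpha>" "\<alpha> \<in> H"
    using assms unfolding left_commuting_def by auto
  then show "\<alpha> \<in> H" "\<alpha> \<in> S" "x \<preceq> w\<^sub>0 \<Longrightarrow> \<alpha> \<otimes> x \<preceq> w\<^sub>0" "x \<preceq> w\<^sub>0 \<Longrightarrow> M (\<alpha> \<otimes> x) = \<alpha> \<otimes> M x"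
    using lift_descent_left[of x w\<^sub>0 \<alpha>]
    unfolding commutes_with_left_def left_descents_def lower_interval_def by auto
qed

lemma para_card_le_1:
  assumes A: "A \<subseteq> S" "finite A" "card A \<le> 1" and x: "x \<in> para A"
  shows "x = \<one> \<or> x \<in> A"
  using x
proof induction
  case (eng h1 h2)
  moreover have "h1 = h2" if "h1 \<in> A" "h2 \<in> A"
    using A card_le_Suc0_iff_eq that by auto
  moreover have "h \<in> carrier W" if "h = \<one> \<or> h \<in> A" for h
    using that A by auto
  ultimately show ?case using A gen_sq by (metis l_one r_one subsetD)
qed (use A gen_inv in \<open>auto simp: subset_iff\<close>)

lemma left_commuting_para:
  assumes "left_commuting A" "x \<in> para A"
  shows "x = \<one> \<or> x \<in> A"
proof (rule para_card_le_1[OF _ _ _ assms(2)])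
  have "finite H" using H_form by auto
  then show "A \<subseteq> S" "finite A" "card A \<le> 1"
    using assms HS finite_subset unfolding left_commuting_def by blast+
qed

lemma left_commuting_mult:
  assumes "left_commuting A" "y \<in> para A" "x \<preceq> w\<^sub>0"
  shows "y \<otimes> x \<preceq> w\<^sub>0" "M (y \<otimes> x) = y \<otimes> M x"
  using left_commuting_para[OF assms(1,2)] left_commutingD[OF assms(1)] assms(3)
    below_w0 below_M by auto

section \<open>Duality under inversion\<close>

lemma lower_interval_inv:
  assumes "v \<in> carrier W"
  shows "lower_interval W S (inv v) = m_inv W ` lower_interval W S v"
proof -
  have "x \<in> m_inv W ` lower_interval W S v" if "x \<preceq> inv v" for x
  proof
    show "inv x \<in> lower_interval W S v"
      using ble_inv[OF that] assms by (simp add: lower_interval_def)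
    show "x = inv (inv x)" using that ble_closed by simp
  qed
  then show ?thesis using ble_inv by (auto simp: lower_interval_def)
qed

lemma inv_eq_inv_iff: "x \<in> carrier W \<Longrightarrow> y \<in> carrier W \<Longrightarrow> inv x = inv y \<longleftrightarrow> x = y"
  by (metis inv_inv)

lemma commutes_with_left_dual:
  assumes "\<beta> \<in> S"
  shows "commutes_with_left W S (inv w\<^sub>0) (\<lambda>x. inv (M (inv x))) \<beta> \<longleftrightarrow>
    commutes_with_right W S w\<^sub>0 M \<beta>"
proof (cases "\<beta> \<in> right_descents W S w\<^sub>0")
  case True
  have "w\<^sub>0 \<in> carrier W" using para_closed[OF HS w0_para] .
  then have d: "\<beta> \<in> left_descents W S (inv w\<^sub>0)"
    and l: "lower_interval W S (inv w\<^sub>0) = m_inv W ` lower_interval W S w\<^sub>0"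
    using True by (auto simp: left_descents_def right_descents_def len_mult_gen lower_interval_inv)
  have "inv (M (inv (\<beta> \<otimes> inv x))) = \<beta> \<otimes> inv (M (inv (inv x))) \<longleftrightarrow> M (x \<otimes> \<beta>) = M x \<otimes> \<beta>"
    if "x \<preceq> w\<^sub>0" for x
  proof -
    have "x \<otimes> \<beta> \<preceq> w\<^sub>0" using lift_descent[OF that assms] True by (simp add: right_descents_def)
    then have "M (x \<otimes> \<beta>) \<in> carrier W" "M x \<in> carrier W" "x \<in> carrier W"
      using that below_M below_w0 by auto
    then show ?thesis
      using inv_eq_inv_iff[of "M (x \<otimes> \<beta>)" "M x \<otimes> \<beta>"] assms by (simp add: inv_mult_group)
  qed
  then show ?thesis
    unfolding commutes_with_left_def commutes_with_right_def l
    using d True by (simp add: lower_interval_def)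
next
  case False
  then have "\<beta> \<notin> left_descents W S (inv w\<^sub>0)"
    using para_closed[OF HS w0_para] assms by (simp add: left_descents_def right_descents_def len_mult_gen)
  then show ?thesis using False unfolding commutes_with_left_def commutes_with_right_def by simp
qed

lemma commutes_with_right_dual:
  assumes "\<beta> \<in> S"
  shows "commutes_with_right W S (inv w\<^sub>0) (\<lambda>x. inv (M (inv x))) \<beta> \<longleftrightarrow>
    commutes_with_left W S w\<^sub>0 M \<beta>"
proof (cases "\<beta> \<in> left_descents W S w\<^sub>0")
  case True
  have "w\<^sub>0 \<in> carrier W" using para_closed[OF HS w0_para] .
  then have d: "\<beta> \<in> right_descents W S (inv w\<^sub>0)"
    and l: "lower_interval W S (inv w\<^sub>0) = m_inv W ` lower_interval W S w\<^sub>0"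
    using True by (auto simp: left_descents_def right_descents_def len_mult_gen lower_interval_inv)
  have "inv (M (inv (inv x \<otimes> \<beta>))) = inv (M (inv (inv x))) \<otimes> \<beta> \<longleftrightarrow> M (\<beta> \<otimes> x) = \<beta> \<otimes> M x"
    if "x \<preceq> w\<^sub>0" for x
  proof -
    have "\<beta> \<otimes> x \<preceq> w\<^sub>0" using lift_descent_left[OF that assms] True by (simp add: left_descents_def)
    then have "M (\<beta> \<otimes> x) \<in> carrier W" "M x \<in> carrier W" "x \<in> carrier W"
      using that below_M below_w0 by auto
    then show ?thesis
      using inv_eq_inv_iff[of "M (\<beta> \<otimes> x)" "\<beta> \<otimes> M x"] assms by (simp add: inv_mult_group)
  qed
  then show ?thesis
    unfolding commutes_with_left_def commutes_with_right_def l
    using d True by (simp add: lower_interval_def)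
next
  case False
  then have "\<beta> \<notin> right_descents W S (inv w\<^sub>0)"
    using para_closed[OF HS w0_para] assms by (simp add: left_descents_def right_descents_def len_mult_gen)
  then show ?thesis using False unfolding commutes_with_left_def commutes_with_right_def by simp
qed

text \<open>Inversion turns a b c into c^-1 b^-1 a^-1, so J and K trade places and M is conjugated
  by inversion.\<close>

lemma dual: "matching_system W S K J H (\<lambda>x. inv (M (inv x))) s (inv w\<^sub>0)"
proof unfold_locales
  have w0: "w\<^sub>0 \<in> carrier W" using para_closed[OF HS w0_para] .
  have below: "inv x \<preceq> w\<^sub>0" if "x \<preceq> inv w\<^sub>0" for x
    using ble_inv[OF that] w0 by simp
  show "K \<subseteq> S" "J \<subseteq> S" "s \<in> S" "H = {s} \<or> (\<exists>t. H = {s, t} \<and> s \<otimes> t \<noteq> t \<otimes> s)"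
    using JS KS sS H_form by auto
  show "K \<inter> J = commuting_gens W S s" using JK by auto
  show "H \<subseteq> K \<union> J" using H_cover by auto
  show "inv (M (inv \<one>)) = s" using M_one sS by simp
  show "inv w\<^sub>0 \<in> para H" using para_inv[OF HS w0_para] .
  show "inv (M (inv x)) \<preceq> inv w\<^sub>0" if "x \<preceq> inv w\<^sub>0" for x
    using ble_inv[OF M_closed[OF below[OF that]]] .
  show "inv (M (inv (inv (M (inv x))))) = x" if "x \<preceq> inv w\<^sub>0" for x
    using below[OF that] M_invol below_M ble_closed[OF that] by simp
qed

lemma dual_left_commuting:
  "matching_system.left_commuting W S H (\<lambda>x. inv (M (inv x))) (inv w\<^sub>0) B \<longleftrightarrow> right_commuting B"
proof -
  interpret dual: matching_system W S K J H "\<lambda>x. inv (M (inv x))" s "inv w\<^sub>0" by (rule dual)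
  show ?thesis unfolding dual.left_commuting_def right_commuting_def
    using commutes_with_left_dual HS by blast
qed

lemma dual_right_commuting:
  "matching_system.right_commuting W S H (\<lambda>x. inv (M (inv x))) (inv w\<^sub>0) A \<longleftrightarrow> left_commuting A"
proof -
  interpret dual: matching_system W S K J H "\<lambda>x. inv (M (inv x))" s "inv w\<^sub>0" by (rule dual)
  show ?thesis unfolding dual.right_commuting_def left_commuting_def
    using commutes_with_right_dual HS by blast
qed

lemma loose_fact_closed:
  assumes "loose_fact A B a b c"
  shows "a \<in> carrier W" "b \<in> carrier W" "c \<in> carrier W" "M b \<in> carrier W"
proof -
  have "K - (H - A) \<subseteq> S" "J - (H - B) \<subseteq> S" using JS KS by auto
  then show "a \<in> carrier W" "b \<in> carrier W" "c \<in> carrier W" "M b \<in> carrier W"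
    using assms para_closed below_M HS unfolding loose_fact_def by blast+
qed

lemma dual_loose_fact:
  assumes c: "a \<in> carrier W" "b \<in> carrier W" "c \<in> carrier W"
  shows "matching_system.loose_fact W S K J H (\<lambda>x. inv (M (inv x))) (inv w\<^sub>0) B A (inv c) (inv b) (inv a)
    \<longleftrightarrow> loose_fact A B a b c"
proof -
  interpret dual: matching_system W S K J H "\<lambda>x. inv (M (inv x))" s "inv w\<^sub>0" by (rule dual)
  have w0: "w\<^sub>0 \<in> carrier W" using para_closed[OF HS w0_para] .
  have sub: "K - (H - A) \<subseteq> S" "J - (H - B) \<subseteq> S" using JS KS by auto
  have "inv b \<preceq> inv w\<^sub>0 \<longleftrightarrow> b \<preceq> w\<^sub>0" using ble_inv[of b w\<^sub>0] ble_inv[of "inv b" "inv w\<^sub>0"] c w0 by auto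
  moreover have "inv c \<otimes> inv b \<otimes> inv a = inv (a \<otimes> b \<otimes> c)" using c by (simp add: inv_mult_group m_assoc)
  ultimately show ?thesis
    unfolding dual.loose_fact_def loose_fact_def dual_left_commuting dual_right_commuting
    using c para_inv_iff[OF HS c(2)] para_inv_iff[OF sub(1) c(1)] para_inv_iff[OF sub(2) c(3)] by auto
qed

lemma dual_realizes:
  assumes "realizes A B u v"
  shows "matching_system.realizes W S K J H (\<lambda>x. inv (M (inv x))) (inv w\<^sub>0) B A (inv u) (inv v)"
proof -
  interpret dual: matching_system W S K J H "\<lambda>x. inv (M (inv x))" s "inv w\<^sub>0" by (rule dual)
  obtain a b c where f: "loose_fact A B a b c" "u = a \<otimes> b \<otimes> c" "v = a \<otimes> M b \<otimes> c"
    using assms unfolding realizes_def by blast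
  note c = loose_fact_closed[OF f(1)]
  have "dual.loose_fact B A (inv c) (inv b) (inv a)" using dual_loose_fact c f by blast
  moreover have "inv u = inv c \<otimes> inv b \<otimes> inv a" "inv v = inv c \<otimes> inv (M (inv (inv b))) \<otimes> inv a"
    using f c by (simp_all add: inv_mult_group m_assoc)
  ultimately show ?thesis unfolding dual.realizes_def by blast
qed

section \<open>Normalizing loose factorizations\<close>

lemma len_mult3_le:
  "a \<in> carrier W \<Longrightarrow> b \<in> carrier W \<Longrightarrow> c \<in> carrier W \<Longrightarrow> len (a \<otimes> b \<otimes> c) \<le> len a + len b + len c"
  using len_mult_le[of "a \<otimes> b" c] len_mult_le[of a b] by simp

text \<open>The part x of a in W_H uses only letters of H that are allowed in a, that is, letters of
  A. Hence x is e or an element of A, and it passes through M.\<close>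

lemma left_normalize:
  assumes f: "loose_fact A B a b c" and a: "a \<notin> min_right W S H"
  shows "\<exists>a' b'. loose_fact A B a' b' c \<and> a' \<otimes> b' = a \<otimes> b \<and> a' \<otimes> M b' = a \<otimes> M b \<and> len a' < len a"
proof -
  note c = loose_fact_closed[OF f]
  let ?X = "K - (H - A)"
  have X: "?X \<subseteq> S" using KS by auto
  obtain a' x where a': "a' \<in> min_right W S H" "x \<in> para H" "a = a' \<otimes> x" "len a = len a' + len x"
    using min_right_factor[OF HS c(1)] .
  have c': "a' \<in> carrier W" "x \<in> carrier W" using a' para_closed[OF HS] by auto
  have aX: "a \<in> para ?X" using f by (simp add: loose_fact_def)
  have a'X: "a' \<in> para ?X" using para_down[OF X _ aX] ble_prefix[OF c'] a' by metis
  have "x \<in> para ?X" using para_down[OF X _ aX] ble_suffix[OF c'] a' by metis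
  then have "x \<in> para (H \<inter> ?X)" using para_Int[OF HS X] a' by blast
  then have xA: "x \<in> para A" using para_mono[of "H \<inter> ?X" A] by blast
  have A: "left_commuting A" and b: "b \<preceq> w\<^sub>0" "b \<in> para H" using f by (auto simp: loose_fact_def)
  have e: "a' \<otimes> (x \<otimes> b) = a \<otimes> b" using a' c c' by (simp add: m_assoc)
  \<comment> \<open>The total product is unchanged, and xb is at most as long as x and b together;
    subadditivity then leaves only equality.\<close>
  have "len (a' \<otimes> (x \<otimes> b) \<otimes> c) = len a' + len (x \<otimes> b) + len c"
  proof (rule antisym)
    show "len (a' \<otimes> (x \<otimes> b) \<otimes> c) \<le> len a' + len (x \<otimes> b) + len c"
      using c c' len_mult3_le by simp
    have "len (x \<otimes> b) \<le> len x + len b" using c c' len_mult_le by simp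
    then show "len a' + len (x \<otimes> b) + len c \<le> len (a' \<otimes> (x \<otimes> b) \<otimes> c)"
      unfolding e using f a' by (simp add: loose_fact_def)
  qed
  then have "loose_fact A B a' (x \<otimes> b) c"
    using f a'X left_commuting_mult[OF A xA b(1)] para_mult[OF a'(2) b(2)] by (simp add: loose_fact_def)
  moreover have "a' \<otimes> M (x \<otimes> b) = a \<otimes> M b"
    using left_commuting_mult[OF A xA b(1)] a' c c' by (simp add: m_assoc)
  moreover have "x \<noteq> \<one>" using a a' by auto
  then have "len a' < len a" using a' len_eq_0_iff[OF c'(2)] by simp
  ultimately show ?thesis using e by blast
qed

lemma right_normalize:
  assumes f: "loose_fact A B a b c" and nc: "c \<notin> min_left W S H"
  shows "\<exists>b' c'. loose_fact A B a b' c' \<and> b' \<otimes> c' = b \<otimes> c \<and> M b' \<otimes> c' = M b \<otimes> c \<and> len c' < len c"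
proof -
  interpret dual: matching_system W S K J H "\<lambda>x. inv (M (inv x))" s "inv w\<^sub>0" by (rule dual)
  note c = loose_fact_closed[OF f]
  have "dual.loose_fact B A (inv c) (inv b) (inv a)" using dual_loose_fact c f by blast
  moreover have "inv c \<notin> min_right W S H" using nc min_left_iff_inv[OF HS] c by blast
  ultimately obtain c' b' where d: "dual.loose_fact B A c' b' (inv a)" "c' \<otimes> b' = inv c \<otimes> inv b"
    "c' \<otimes> inv (M (inv b')) = inv c \<otimes> inv (M (inv (inv b)))" "len c' < len (inv c)"
    using dual.left_normalize by blast
  note c' = dual.loose_fact_closed[OF d(1)]
  have "loose_fact A B a (inv b') (inv c')"
    using dual_loose_fact[of a "inv b'" "inv c'"] c c' d by simp
  moreover note c'' = loose_fact_closed[OF this]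
  moreover have "inv b' \<otimes> inv c' = b \<otimes> c"
    using arg_cong[OF d(2), of "m_inv W"] c c' by (simp add: inv_mult_group)
  moreover have "M (inv b') \<otimes> inv c' = M b \<otimes> c"
    using arg_cong[OF d(3), of "m_inv W"] c c' c'' by (simp add: inv_mult_group)
  ultimately show ?thesis using d(4) c c' by (metis len_inv)
qed

lemma para_commute:
  assumes g: "g \<in> S" and com: "\<And>h. h \<in> H \<Longrightarrow> g \<otimes> h = h \<otimes> g" and x: "x \<in> para H"
  shows "x \<otimes> g = g \<otimes> x"
  using x
proof induction
  case (eng h1 h2)
  then have "h1 \<in> carrier W" "h2 \<in> carrier W" using para_closed[OF HS] by auto
  then have "h1 \<otimes> h2 \<otimes> g = h1 \<otimes> (g \<otimes> h2)" using eng g by (simp add: m_assoc)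
  also have "\<dots> = g \<otimes> (h1 \<otimes> h2)"
    using eng g \<open>h1 \<in> carrier W\<close> \<open>h2 \<in> carrier W\<close> by (simp add: m_assoc[symmetric])
  finally show ?case .
next
  case (inv h)
  then show ?case using com[of h] HS gen_inv by (metis subsetD)
qed (use g com in auto)

text \<open>Another element commuting with g would yield one ending in t, say zt with z minimal
  modulo {g, t}. Then g z = z (tgt), and the dichotomy for g z forces tgt to be e, g or t, which is
  impossible for distinct generators that do not commute.\<close>

lemma commuting_element:
  assumes g: "g \<in> J \<inter> K" "g \<notin> H" and t: "t \<in> H" "g \<otimes> t \<noteq> t \<otimes> g"
    and x: "x \<in> para H" "x \<otimes> g = g \<otimes> x"
  shows "x = \<one> \<or> x = s"
proof (rule ccontr)
  assume n: "\<not> (x = \<one> \<or> x = s)"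
  have gS: "g \<in> S" "g \<otimes> s = s \<otimes> g" using commuting g by auto
  have tS: "t \<in> S" using t HS by auto
  have xc: "x \<in> carrier W" using x para_closed[OF HS] by blast
  have sub: "{g, t} \<subseteq> S" using gS tS by simp
  \<comment> \<open>Removing a right descent s preserves commutation with g, so y may be assumed to
    end in the other element of H.\<close>
  obtain y where y: "y \<in> para H" "y \<noteq> \<one>" "y \<otimes> g = g \<otimes> y" "len (y \<otimes> s) = Suc (len y)"
  proof (cases "len (x \<otimes> s) = Suc (len x)")
    case False
    then have "len x = Suc (len (x \<otimes> s))" using gen_right_cases[OF sS xc] by metis
    moreover have "x \<otimes> s \<noteq> \<one>" using n sS xc by (metis gen_cancel_right l_one gen_closed)
    moreover have "x \<otimes> s \<otimes> g = g \<otimes> (x \<otimes> s)"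
    proof -
      have "x \<otimes> s \<otimes> g = x \<otimes> (g \<otimes> s)" unfolding gS(2) using xc sS gS(1) by (simp add: m_assoc)
      also have "\<dots> = (x \<otimes> g) \<otimes> s" using xc sS gS(1) by (simp add: m_assoc)
      finally show ?thesis unfolding x(2) using xc sS gS(1) by (simp add: m_assoc)
    qed
    ultimately show ?thesis using that[of "x \<otimes> s"] para_mult[OF x(1) para_gen[OF sH]] sS xc by simp
  qed (use that x n in auto)
  have yc: "y \<in> carrier W" using y para_closed[OF HS] by blast
  from para_descent_right[OF HS y(1,2)] obtain j
    where j: "j \<in> H" "len y = Suc (len (y \<otimes> j))" "y \<otimes> j \<in> para H" .
  have "H = {s, t}" "t \<noteq> s" using H_form t gS by auto
  then have "j = t" using j y by auto
  define z where "z = y \<otimes> t"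
  have zc: "z \<in> carrier W" "z \<otimes> t = y" using yc tS by (simp_all add: z_def)
  have zH: "z \<in> para H" using j \<open>j = t\<close> z_def by simp
  have zmin: "z \<in> min_right W S {g, t}"
    unfolding min_right_iff[OF sub] using len_para_gen_outside[OF HS zH gS(1) g(2)] zc j \<open>j = t\<close> z_def
    by auto
  have e: "g \<otimes> z = z \<otimes> (t \<otimes> g \<otimes> t)"
    unfolding z_def using y(3) yc tS gS(1) by (simp add: m_assoc) (simp add: m_assoc[symmetric])
  have p: "t \<otimes> g \<otimes> t \<in> para {g, t}" by (intro para_mult para_gen) auto
  have no: "t \<otimes> g \<otimes> t \<noteq> t" "t \<otimes> g \<otimes> t \<noteq> g" "t \<otimes> g \<otimes> t \<noteq> \<one>"
  proof -
    have r: "t \<otimes> (t \<otimes> g \<otimes> t) \<otimes> t = g" using tS gS by (simp add: m_assoc)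
    then show "t \<otimes> g \<otimes> t \<noteq> t" using t(1) g(2) tS by (auto simp: gen_sq)
    show "t \<otimes> g \<otimes> t \<noteq> \<one>" using r gen_neq_one[OF gS(1)] tS by (auto simp: gen_sq)
    show "t \<otimes> g \<otimes> t \<noteq> g" using t(2) tS gS gen_cancel_right[of t "t \<otimes> g"] by fastforce
  qed
  from sub zmin gS(1) show False
  proof (cases rule: min_right_gen_cases)
    case min
    have "g \<otimes> z \<otimes> \<one> = z \<otimes> (t \<otimes> g \<otimes> t)" using e zc gS tS by simp
    from min_right_unique[OF sub min zmin para_one p this] show ?thesis using no by simp
  next
    case (fixed i)
    then have "i = t \<otimes> g \<otimes> t" using e zc tS gS sub by auto
    then show ?thesis using fixed no by auto
  qed
qed

text \<open>If g commutes with H, both sides are g. Otherwise x^-1 = v y with y in W_A and v minimal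
  modulo A \<union> {g}. The hypothesis puts g v into the coset of v, so the dichotomy compares g v
  with v.\<close>

lemma matching_conjugation:
  assumes g: "g \<in> J \<inter> K" "g \<notin> H" and A: "left_commuting A" and x: "x \<preceq> w\<^sub>0"
    and con: "x \<otimes> g \<otimes> inv x \<in> para (insert g A)"
  shows "M x \<otimes> g \<otimes> inv (M x) = x \<otimes> g \<otimes> inv x"
proof (cases "\<forall>h \<in> H. g \<otimes> h = h \<otimes> g")
  case True
  have gS: "g \<in> S" using commuting g by blast
  have "y \<otimes> g \<otimes> inv y = g" if "y \<in> para H" for y
    using para_commute[OF gS _ that] True para_closed[OF HS that] gS by (simp add: m_assoc)
  then show ?thesis using below_w0[OF x] below_M[OF x] by simp
next
  case False
  then obtain t where t: "t \<in> H" "g \<otimes> t \<noteq> t \<otimes> g" by blast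
  have gS: "g \<in> S" "g \<otimes> s = s \<otimes> g" using commuting g by auto
  have xc: "x \<in> carrier W" "x \<in> para H" using below_w0[OF x] by auto
  have AH: "A \<subseteq> H" using A by (simp add: left_commuting_def)
  then have AS: "A \<subseteq> S" "insert g A \<subseteq> S" using HS gS by auto
  obtain v y where v: "v \<in> min_right W S A" "y \<in> para A" "inv x = v \<otimes> y" "len (inv x) = len v + len y"
    using min_right_factor[OF AS(1) inv_closed[OF xc(1)]] .
  have vc: "v \<in> carrier W" "y \<in> carrier W" using v para_closed[OF AS(1)] by auto
  have vH: "v \<in> para H"
    using para_down[OF HS _ para_inv[OF HS xc(2)]] ble_prefix[OF vc] v by metis
  have vmin: "v \<in> min_right W S (insert g A)"
    using v(1) len_para_gen_outside[OF HS vH gS(1) g(2)] unfolding min_right_iff[OF AS(1)] min_right_iff[OF AS(2)]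
    by auto
  let ?z = "y \<otimes> (x \<otimes> g \<otimes> inv x) \<otimes> inv y"
  have yA: "y \<in> para (insert g A)" using v(2) para_mono[of A "insert g A"] by blast
  have z: "?z \<in> para (insert g A)"
    by (rule para_mult[OF para_mult[OF yA con] para_inv[OF AS(2) yA]])
  have xe: "x = inv y \<otimes> inv v"
    using arg_cong[OF v(3), of "m_inv W"] xc vc by (simp add: inv_mult_group)
  have e: "g \<otimes> v = v \<otimes> ?z"
    unfolding v(3) unfolding xe using vc gS by (simp add: m_assoc)
  have "v = \<one> \<or> v = s"
    using AS(2) vmin gS(1)
  proof (cases rule: min_right_gen_cases)
    case min
    have "g \<otimes> v \<otimes> \<one> = v \<otimes> ?z" using e vc gS xc by simp
    from min_right_unique[OF AS(2) min vmin para_one z this] have "?z = \<one>" by simp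
    then have "g \<otimes> v = v" using e vc by simp
    then show ?thesis using gen_neq_one[OF gS(1)] vc gS by (metis gen_closed r_cancel_one)
  next
    case (fixed i)
    \<comment> \<open>For i in A, the equation g v = v i would put g into W_H, although g is not in
      H.\<close>
    have "i = g"
    proof (rule ccontr)
      assume "i \<noteq> g"
      then have i: "i \<in> A" "i \<in> H" "i \<in> S" using fixed AH HS by auto
      have "g = v \<otimes> i \<otimes> inv v"
        using arg_cong[OF fixed(2), of "\<lambda>q. q \<otimes> inv v"] vc i gS by (simp add: m_assoc)
      moreover have "v \<otimes> i \<otimes> inv v \<in> para H"
        using vH para_gen[OF i(2)] para_inv[OF HS vH] by (intro para_mult)
      ultimately show False using para_gen_iff[OF HS gS(1)] g by simp
    qed
    then show ?thesis using commuting_element[OF g t vH] fixed by simp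
  qed
  then have vw: "v \<preceq> w\<^sub>0" "inv v = v" "M v = v \<otimes> s"
    using one_below s_below M_one sS by (auto simp: gen_sq)
  have "y = \<one> \<or> y \<in> S" using left_commuting_para[OF A v(2)] AS by auto
  then have yi: "inv y = y" by auto
  \<comment> \<open>x is y times e or s. The factor y passes through M, and M exchanges e and
    s.\<close>
  have "M x = x \<otimes> s"
    using left_commuting_mult[OF A v(2) vw(1)] vw vc sS unfolding xe yi by (simp add: m_assoc)
  then show ?thesis using xc gS sS
    by (simp add: inv_mult_group m_assoc) (simp add: m_assoc[symmetric] gS(2)[symmetric])
qed

text \<open>\<open>g\<close> passes through \<open>b\<close> and is cancelled in \<open>a\<close>; the conjugate \<open>b g b\<inverse>\<close> then lies in
  the parabolic subgroup of \<open>A \<union> {g}\<close>, so that passing through \<open>M(b)\<close> has the same effect.\<close>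

lemma transfer_right:
  assumes f: "loose_fact A B a b c" and g: "g \<in> J \<inter> K" "g \<notin> H"
    and d: "len (a \<otimes> b \<otimes> g) < len (a \<otimes> b)"
  shows "\<exists>a'. loose_fact A B a' b (g \<otimes> c) \<and> a' \<otimes> b \<otimes> (g \<otimes> c) = a \<otimes> b \<otimes> c \<and>
    a' \<otimes> M b \<otimes> (g \<otimes> c) = a \<otimes> M b \<otimes> c \<and> len a' < len a \<and> len (g \<otimes> c) \<le> Suc (len c)"
proof -
  note c = loose_fact_closed[OF f]
  have gS: "g \<in> S" "g \<in> carrier W" using commuting g by auto
  let ?X = "K - (H - A)" and ?Y = "J - (H - B)" and ?t = "b \<otimes> g \<otimes> inv b"
  have XY: "?X \<subseteq> S" "?Y \<subseteq> S" using KS JS by auto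
  have A: "left_commuting A" and b: "b \<preceq> w\<^sub>0" "b \<in> para H" and a: "a \<in> para ?X" and cY: "c \<in> para ?Y"
    and l: "len (a \<otimes> b \<otimes> c) = len a + len b + len c"
    using f by (auto simp: loose_fact_def)
  have tc: "?t \<in> carrier W" using c gS by simp
  have t: "?t \<in> refls" using refl_conj gen_refl gS c by blast
  \<comment> \<open>g lies outside H and therefore lengthens b, so by exchange the shortening takes
    place in a.\<close>
  have at: "len (a \<otimes> ?t) < len a"
    using exchange_right_iff[OF gen_refl[OF gS(1)] c(1,2)] d len_para_gen_outside[OF HS b(2) gS(1) g(2)] by simp
  have tX: "?t \<in> para ?X" using para_refl_right[OF XY(1) a t at] .
  have gH: "insert g H \<subseteq> S" using gS HS by simp
  have bH: "b \<in> para (insert g H)" using b(2) para_mono[of H "insert g H"] by blast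
  have "?t \<in> para (insert g H)"
    by (rule para_mult[OF para_mult[OF bH para_gen[OF insertI1]] para_inv[OF gH bH]])
  then have "?t \<in> para (insert g H \<inter> ?X)" using para_Int[OF gH XY(1)] tX by blast
  then have tA: "?t \<in> para (insert g A)" using para_mono[of "insert g H \<inter> ?X" "insert g A"] by blast
  have conj: "M b \<otimes> g \<otimes> inv (M b) = ?t" by (rule matching_conjugation[OF g A b(1) tA])
  let ?a = "a \<otimes> ?t"
  have pass: "?a \<otimes> y \<otimes> (g \<otimes> c) = a \<otimes> y \<otimes> c" if "y \<otimes> g \<otimes> inv y = ?t" "y \<in> carrier W" for y
    unfolding that(1)[symmetric] using that(2) c gS by (simp add: m_assoc)
  have gc: "len (g \<otimes> c) \<le> Suc (len c)" using len_mult_le[of g c] c gS by (simp add: len_gen)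
  have "len (?a \<otimes> b \<otimes> (g \<otimes> c)) = len ?a + len b + len (g \<otimes> c)"
  proof (rule antisym)
    show "len (?a \<otimes> b \<otimes> (g \<otimes> c)) \<le> len ?a + len b + len (g \<otimes> c)"
      by (rule len_mult3_le) (use c gS tc in auto)
    show "len ?a + len b + len (g \<otimes> c) \<le> len (?a \<otimes> b \<otimes> (g \<otimes> c))"
      unfolding pass[OF HOL.refl c(2)] l using at gc by simp
  qed
  moreover have "?a \<in> para ?X" using para_mult[OF a tX] .
  moreover have "g \<otimes> c \<in> para ?Y" using para_mult[OF para_gen cY] g by blast
  ultimately have "loose_fact A B ?a b (g \<otimes> c)" using f by (simp add: loose_fact_def)
  then show ?thesis using pass[OF HOL.refl c(2)] pass[OF conj c(4)] at gc by blast
qed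

lemma canonical_exists:
  assumes "loose_fact A B a b c"
  shows "\<exists>a' b' c'. loose_fact A B a' b' c' \<and> a' \<otimes> b' \<otimes> c' = a \<otimes> b \<otimes> c \<and>
    a' \<otimes> M b' \<otimes> c' = a \<otimes> M b \<otimes> c \<and> a' \<in> min_right W S H \<and> c' \<in> min_left W S H \<and>
    a' \<otimes> b' \<in> min_right W S (J \<inter> K - H)"
  using assms
\<comment> \<open>A transfer shortens a but may lengthen c by one letter, whence the weight 2. The
  other two moves shorten a or c and leave the other one unchanged.\<close>
proof (induction "2 * len a + len c" arbitrary: a b c rule: less_induct)
  case less
  note c = loose_fact_closed[OF less.prems]
  have sub: "J \<inter> K - H \<subseteq> S" using JS by auto
  consider "a \<notin> min_right W S H" | "c \<notin> min_left W S H"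
    | g where "g \<in> J \<inter> K" "g \<notin> H" "len (a \<otimes> b \<otimes> g) < len (a \<otimes> b)"
    | "a \<in> min_right W S H" "c \<in> min_left W S H" "a \<otimes> b \<in> min_right W S (J \<inter> K - H)"
    unfolding min_right_def right_descents_def using c by blast
  then show ?case
  proof cases
    case 1
    from left_normalize[OF less.prems 1] obtain a' b' where
      *: "loose_fact A B a' b' c" "a' \<otimes> b' = a \<otimes> b" "a' \<otimes> M b' = a \<otimes> M b" "len a' < len a" by blast
    then show ?thesis using less.hyps[OF _ *(1)] by simp
  next
    case 2
    from right_normalize[OF less.prems 2] obtain b' c' where
      *: "loose_fact A B a b' c'" "b' \<otimes> c' = b \<otimes> c" "M b' \<otimes> c' = M b \<otimes> c" "len c' < len c" by blast
    note c' = loose_fact_closed[OF *(1)]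
    have "a \<otimes> b' \<otimes> c' = a \<otimes> b \<otimes> c" "a \<otimes> M b' \<otimes> c' = a \<otimes> M b \<otimes> c"
      using *(2,3) c c' by (simp_all add: m_assoc)
    then show ?thesis using less.hyps[OF _ *(1)] *(4) by simp
  next
    case (3 g)
    from transfer_right[OF less.prems 3] obtain a' where
      *: "loose_fact A B a' b (g \<otimes> c)" "a' \<otimes> b \<otimes> (g \<otimes> c) = a \<otimes> b \<otimes> c"
      "a' \<otimes> M b \<otimes> (g \<otimes> c) = a \<otimes> M b \<otimes> c" "len a' < len a" "len (g \<otimes> c) \<le> Suc (len c)" by blast
    then show ?thesis using less.hyps[OF _ *(1)] by simp
  next
    case 4
    then show ?thesis using less.prems by blast
  qed
qed

section \<open>Uniqueness of the normal form\<close>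

lemma min_right_or_mult_s:
  assumes HJ: "H \<inter> J = {s}" and e: "e \<in> para K" "e \<in> min_right W S (J \<inter> K - H)"
  shows "\<exists>d \<in> min_right W S J. e = d \<or> e = d \<otimes> s"
proof -
  have ec: "e \<in> carrier W" using e by simp
  have sub: "J \<inter> K - H \<subseteq> S" using JS by auto
  \<comment> \<open>A right descent in J of an element of W_K lies in J \<inter> K; inside H only s
    is possible there.\<close>
  have *: "d \<in> min_right W S J"
    if d: "d \<in> para K" "len (d \<otimes> s) = Suc (len d)"
      and up: "\<And>g. g \<in> J \<inter> K - H \<Longrightarrow> \<not> len (d \<otimes> g) < len d" for d
    unfolding min_right_iff[OF JS]
  proof (intro conjI ballI)
    show dc: "d \<in> carrier W" using d para_closed[OF KS] by blast
    fix j assume j: "j \<in> J"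
    then have jS: "j \<in> S" using JS by auto
    have "\<not> len (d \<otimes> j) < len d"
    proof
      assume l: "len (d \<otimes> j) < len d"
      then have "j \<in> K" using para_refl_right[OF KS d(1) gen_refl[OF jS]] para_gen_iff[OF KS jS] by blast
      then have "j \<in> H" using up[of j] l j by blast
      then have "j = s" using HJ j by auto
      then show False using l d(2) by simp
    qed
    then show "len (d \<otimes> j) = Suc (len d)" using gen_right_cases[OF jS dc] by force
  qed
  have up: "len (e \<otimes> g) = Suc (len e)" if "g \<in> J \<inter> K - H" for g
    using e(2) that unfolding min_right_iff[OF sub] by blast
  show ?thesis
  proof (cases "len (e \<otimes> s) = Suc (len e)")
    case True
    then have "e \<in> min_right W S J" using *[OF e(1)] up by force
    then show ?thesis by blast
  next
    case False
    then have l: "len e = Suc (len (e \<otimes> s))" using gen_right_cases[OF sS ec] by metis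
    have "e \<otimes> s \<in> min_right W S J"
    proof (rule *)
      show "e \<otimes> s \<in> para K" using para_mult[OF e(1) para_gen] sJK by blast
      show "len (e \<otimes> s \<otimes> s) = Suc (len (e \<otimes> s))" using l ec sS by simp
      fix g assume g: "g \<in> J \<inter> K - H"
      then have gS: "g \<in> S" "g \<otimes> s = s \<otimes> g" using commuting by auto
      \<comment> \<open>Since g commutes with s, eg = (es)gs. As eg is two letters longer than es, g
        cannot shorten es.\<close>
      have "e \<otimes> s \<otimes> g \<otimes> s = e \<otimes> g"
        using gS ec sS by (metis gen_cancel_right gen_closed m_assoc m_closed)
      then have "len (e \<otimes> g) \<le> Suc (len (e \<otimes> s \<otimes> g))"
        using len_mult_le[of "e \<otimes> s \<otimes> g" s] ec sS gS by (simp add: len_gen)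
      then show "\<not> len (e \<otimes> s \<otimes> g) < len (e \<otimes> s)" using up[OF g] l by simp
    qed
    moreover have "e = e \<otimes> s \<otimes> s" using ec sS by simp
    ultimately show ?thesis by blast
  qed
qed

lemma len_s_mult_min_left:
  "c \<in> min_left W S H \<Longrightarrow> len (s \<otimes> c) = Suc (len c)"
  using min_left_iff[OF HS] sH by blast

text \<open>If e = ds, then e c = d (sc), where s lengthens c because it lies in H. Both cases thus
  come from length additivity over W_J.\<close>

lemma len_canonical_mult:
  assumes HJ: "H \<inter> J = {s}" and e: "e \<in> para K" "e \<in> min_right W S (J \<inter> K - H)"
    and c: "c \<in> para J" "c \<in> min_left W S H"
  shows "len (e \<otimes> c) = len e + len c"
proof -
  obtain d where d: "d \<in> min_right W S J" "e = d \<or> e = d \<otimes> s"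
    using min_right_or_mult_s[OF HJ e] by blast
  have cc: "c \<in> carrier W" "d \<in> carrier W" using c d by auto
  from d(2) show ?thesis
  proof
    assume "e = d"
    then show ?thesis using len_min_right_mult[OF JS d(1) c(1)] by simp
  next
    assume ds: "e = d \<otimes> s"
    have "len (d \<otimes> (s \<otimes> c)) = len d + len (s \<otimes> c)"
      using len_min_right_mult[OF JS d(1) para_mult[OF para_gen c(1)]] sJK by simp
    moreover have "len e = Suc (len d)"
      using len_min_right_mult[OF JS d(1) para_gen[OF sJK(1)]] ds sS by (simp add: len_gen)
    ultimately show ?thesis using len_s_mult_min_left[OF c(2)] ds cc sS by (simp add: m_assoc)
  qed
qed

text \<open>Both products are factored over W_J with second factor c or sc. The mixed cases would
  give sc = c' or sc' = c, but s lengthens both c and c'.\<close>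

lemma canonical_unique:
  assumes HJ: "H \<inter> J = {s}"
    and e: "e \<in> para K" "e \<in> min_right W S (J \<inter> K - H)"
    and e': "e' \<in> para K" "e' \<in> min_right W S (J \<inter> K - H)"
    and c: "c \<in> para J" "c \<in> min_left W S H"
    and c': "c' \<in> para J" "c' \<in> min_left W S H"
    and eq: "e \<otimes> c = e' \<otimes> c'"
  shows "e = e' \<and> c = c'"
proof -
  obtain d where d: "d \<in> min_right W S J" "e = d \<or> e = d \<otimes> s"
    using min_right_or_mult_s[OF HJ e] by blast
  obtain d' where d': "d' \<in> min_right W S J" "e' = d' \<or> e' = d' \<otimes> s"
    using min_right_or_mult_s[OF HJ e'] by blast
  have cc: "c \<in> carrier W" "d \<in> carrier W" "c' \<in> carrier W" "d' \<in> carrier W" using c d c' d' by auto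
  have sc: "s \<otimes> c \<in> para J" "s \<otimes> c' \<in> para J" using c c' sJK para_mult para_gen by blast+
  note l = len_s_mult_min_left[OF c(2)] len_s_mult_min_left[OF c'(2)]
  have ne: "s \<otimes> c \<noteq> c'" "s \<otimes> c' \<noteq> c"
    using l gen_cancel[OF sS cc(1)] gen_cancel[OF sS cc(3)] by force+
  from d(2) d'(2) show ?thesis
  proof (elim disjE)
    assume "e = d" "e' = d'"
    then show ?thesis using min_right_unique[OF JS d(1) d'(1) c(1) c'(1)] eq by simp
  next
    assume "e = d" "e' = d' \<otimes> s"
    then have "d \<otimes> c = d' \<otimes> (s \<otimes> c')" using eq cc sS by (simp add: m_assoc)
    then show ?thesis using min_right_unique[OF JS d(1) d'(1) c(1) sc(2)] ne by simp
  next
    assume "e = d \<otimes> s" "e' = d'"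
    then have "d \<otimes> (s \<otimes> c) = d' \<otimes> c'" using eq cc sS by (simp add: m_assoc)
    then show ?thesis using min_right_unique[OF JS d(1) d'(1) sc(1) c'(1)] ne by simp
  next
    assume "e = d \<otimes> s" "e' = d' \<otimes> s"
    then have "d \<otimes> (s \<otimes> c) = d' \<otimes> (s \<otimes> c')" using eq cc sS by (simp add: m_assoc)
    then have "d = d' \<and> s \<otimes> c = s \<otimes> c'"
      using min_right_unique[OF JS d(1) d'(1) sc] by simp
    then show ?thesis using \<open>e = d \<otimes> s\<close> \<open>e' = d' \<otimes> s\<close> cc sS by (metis gen_cancel)
  qed
qed

lemma loose_fact_para:
  assumes "loose_fact A B a b c" "H \<subseteq> K"
  shows "a \<in> para K" "a \<otimes> b \<in> para K" "c \<in> para J"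
proof -
  have "a \<in> para (K - (H - A))" "c \<in> para (J - (H - B))" "b \<in> para H"
    using assms(1) by (auto simp: loose_fact_def)
  then show "a \<in> para K" "c \<in> para J" "a \<otimes> b \<in> para K"
    using para_mono[of _ K] para_mono[of _ J] assms(2) para_mult by (metis Diff_subset)+
qed

lemma realizes_canonical:
  assumes "realizes A B u v"
  obtains a b c where "loose_fact A B a b c" "u = a \<otimes> b \<otimes> c" "v = a \<otimes> M b \<otimes> c"
    "a \<in> min_right W S H" "c \<in> min_left W S H" "a \<otimes> b \<in> min_right W S (J \<inter> K - H)"
proof -
  obtain a b c where f: "loose_fact A B a b c" "u = a \<otimes> b \<otimes> c" "v = a \<otimes> M b \<otimes> c"
    using assms unfolding realizes_def by blast
  from canonical_exists[OF f(1)] obtain a' b' c' where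
    *: "loose_fact A B a' b' c'" "a' \<otimes> b' \<otimes> c' = u" "a' \<otimes> M b' \<otimes> c' = v"
      "a' \<in> min_right W S H" "c' \<in> min_left W S H" "a' \<otimes> b' \<in> min_right W S (J \<inter> K - H)"
    unfolding f(2,3) by blast
  show ?thesis by (rule that[OF *(1) *(2,3)[symmetric] *(4-6)])
qed

lemma realizes_closed:
  assumes "realizes A B u v"
  shows "u \<in> carrier W" "v \<in> carrier W"
proof -
  obtain a b c where f: "loose_fact A B a b c" "u = a \<otimes> b \<otimes> c" "v = a \<otimes> M b \<otimes> c"
    using assms unfolding realizes_def by blast
  then show "u \<in> carrier W" "v \<in> carrier W" using loose_fact_closed[OF f(1)] by auto
qed

lemma realizes_unique_right:
  assumes HK: "H \<subseteq> K" and HJ: "H \<inter> J = {s}"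
    and "realizes A B u v" "realizes A' B' u v'"
  shows "v = v'"
proof -
  obtain a b c where f: "loose_fact A B a b c" "u = a \<otimes> b \<otimes> c" "v = a \<otimes> M b \<otimes> c"
    "a \<in> min_right W S H" "c \<in> min_left W S H" "a \<otimes> b \<in> min_right W S (J \<inter> K - H)"
    using realizes_canonical[OF assms(3)] .
  obtain a' b' c' where f': "loose_fact A' B' a' b' c'" "u = a' \<otimes> b' \<otimes> c'" "v' = a' \<otimes> M b' \<otimes> c'"
    "a' \<in> min_right W S H" "c' \<in> min_left W S H" "a' \<otimes> b' \<in> min_right W S (J \<inter> K - H)"
    using realizes_canonical[OF assms(4)] .
  note p = loose_fact_para[OF f(1) HK] and p' = loose_fact_para[OF f'(1) HK]
  have "a \<otimes> b = a' \<otimes> b' \<and> c = c'"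
    using canonical_unique[OF HJ p(2) f(6) p'(2) f'(6) p(3) f(5) p'(3) f'(5)] f(2) f'(2) by simp
  moreover have "b \<in> para H" "b' \<in> para H" using f(1) f'(1) by (auto simp: loose_fact_def)
  ultimately show ?thesis using min_right_unique[OF HS f(4) f'(4)] f(3) f'(3) by blast
qed

text \<open>The bounds of the two factorizations may differ; this is what allows a comparison with
  an arbitrary S-factorization, whose bounds are its own supports.\<close>

lemma realizes_unique:
  assumes "realizes A B u v" "realizes A' B' u v'"
  shows "v = v'"
proof -
  interpret dual: matching_system W S K J H "\<lambda>x. inv (M (inv x))" s "inv w\<^sub>0" by (rule dual)
  note H_side
  then show ?thesis
  proof (elim disjE conjE)
    assume "H \<subseteq> K" "H \<inter> J = {s}"
    then show ?thesis using realizes_unique_right assms by blast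
  next
    assume "H \<subseteq> J" "H \<inter> K = {s}"
    then have "inv v = inv v'"
      using dual.realizes_unique_right dual_realizes[OF assms(1)] dual_realizes[OF assms(2)] by blast
    then show ?thesis
      using inv_eq_inv_iff[OF realizes_closed(2)[OF assms(1)] realizes_closed(2)[OF assms(2)]] by simp
  qed
qed

section \<open>Left multiplication by a generator\<close>

lemma min_left_gen_mult:
  assumes HJ: "H \<inter> J = {s}" and g: "g \<in> J \<inter> K" "g \<notin> H" and c: "c \<in> para J" "c \<in> min_left W S H"
  shows "g \<otimes> c \<in> min_left W S H"
  unfolding min_left_iff[OF HS]
proof (intro conjI ballI)
  have gS: "g \<in> S" "g \<otimes> s = s \<otimes> g" using commuting g by auto
  have cc: "c \<in> carrier W" using c by simp
  show gc: "g \<otimes> c \<in> carrier W" using gS cc by simp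
  have gcJ: "g \<otimes> c \<in> para J" using para_mult[OF para_gen c(1)] g by blast
  fix h assume h: "h \<in> H"
  then have hS: "h \<in> S" using HS by auto
  have "\<not> len (h \<otimes> (g \<otimes> c)) < len (g \<otimes> c)"
  proof
    assume l: "len (h \<otimes> (g \<otimes> c)) < len (g \<otimes> c)"
    then have "h \<in> J" using para_refl_left[OF JS gcJ gen_refl[OF hS]] para_gen_iff[OF JS hS] by blast
    then have h': "h = s" using h HJ by auto
    \<comment> \<open>Conjugation by g fixes s, so by exchange s would have to shorten g or
      c.\<close>
    have "inv g \<otimes> s \<otimes> g = s" using gS sS by (simp add: m_assoc flip: gS(2))
    then have "(len (s \<otimes> g) < len g) \<noteq> (len (s \<otimes> c) < len c)"
      using exchange_iff[OF gen_refl[OF sS], of g c] l h' gS cc by simp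
    moreover have "\<not> len (s \<otimes> c) < len c" using len_s_mult_min_left[OF c(2)] by simp
    moreover have "\<not> len (s \<otimes> g) < len g"
      using gen_mult_shorter_iff[OF gS(1) gen_refl[OF sS]] g sH gS(2) by auto
    ultimately show False by simp
  qed
  then show "len (h \<otimes> (g \<otimes> c)) = Suc (len (g \<otimes> c))"
    using gen_left_cases[OF hS gc] by force
qed

text \<open>Conjugation by s fixes each g in J \<inter> K, so by exchange a descent g of ys would be
  a descent of y.\<close>

lemma min_right_mult_s:
  assumes y: "y \<in> min_right W S (J \<inter> K - H)"
  shows "y \<otimes> s \<in> min_right W S (J \<inter> K - H)"
proof -
  have sub: "J \<inter> K - H \<subseteq> S" using JS by auto
  have yc: "y \<in> carrier W" using y by simp
  have "len (y \<otimes> s \<otimes> g) = Suc (len (y \<otimes> s))" if g: "g \<in> J \<inter> K - H" for g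
  proof -
    have gS: "g \<in> S" "g \<otimes> s = s \<otimes> g" using commuting g by auto
    have "s \<otimes> g \<otimes> inv s = g" using sS gS by (simp flip: gS(2))
    moreover have "\<not> len (s \<otimes> g) < len s"
      using gen_mult_shorter_iff[OF sS gen_refl[OF gS(1)]] g sH by auto
    moreover have "\<not> len (y \<otimes> g) < len y" using y g unfolding min_right_iff[OF sub] by auto
    ultimately have "\<not> len (y \<otimes> s \<otimes> g) < len (y \<otimes> s)"
      using exchange_right_iff[OF gen_refl[OF gS(1)] yc gen_closed[OF sS]] by simp
    then show ?thesis using gen_right_cases[OF gS(1), of "y \<otimes> s"] yc sS by force
  qed
  then show ?thesis unfolding min_right_iff[OF sub] using yc sS by simp
qed

text \<open>h = p^-1 r p lies in the parabolic subgroup of K - (H - A), and a generator lying there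
  belongs to K - (H - A) itself.\<close>

lemma left_absorb:
  assumes r: "r \<in> K - (H - A)" and f: "loose_fact A B p b c" and h: "h \<in> H" "r \<otimes> p = p \<otimes> h"
  shows "h \<in> A"
proof -
  note cl = loose_fact_closed[OF f]
  have X: "K - (H - A) \<subseteq> S" using KS by auto
  have p: "p \<in> para (K - (H - A))" using f by (simp add: loose_fact_def)
  have hS: "h \<in> S" using h HS by auto
  have rc: "r \<in> carrier W" using r X by auto
  have "h = inv p \<otimes> r \<otimes> p" using h hS cl rc by (simp add: m_assoc)
  moreover have "inv p \<otimes> r \<otimes> p \<in> para (K - (H - A))"
    by (rule para_mult[OF para_mult[OF para_inv[OF X p] para_gen[OF r]] p])
  ultimately have "h \<in> K - (H - A)" using para_gen_iff[OF X hS] by simp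
  then show ?thesis using h by blast
qed

text \<open>When \<open>r p = p h\<close> with \<open>h \<in> H\<close>, left multiplication by \<open>r\<close> acts on the middle factor as \<open>\<lambda>\<^sub>h\<close>,
  which commutes with \<open>M\<close>.\<close>

lemma realizes_absorb:
  assumes f: "loose_fact A B p b c" and r: "r \<in> K - (H - A)" and h: "h \<in> H" "r \<otimes> p = p \<otimes> h"
    and l: "len (p \<otimes> (h \<otimes> b) \<otimes> c) = len p + len (h \<otimes> b) + len c"
  shows "realizes A B (r \<otimes> (p \<otimes> b \<otimes> c)) (r \<otimes> (p \<otimes> M b \<otimes> c))"
proof -
  note cl = loose_fact_closed[OF f]
  have A: "left_commuting A" and b: "b \<preceq> w\<^sub>0" "b \<in> para H" using f by (auto simp: loose_fact_def)
  have rS: "r \<in> S" "h \<in> S" using r KS h HS by auto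
  note hb = left_commutingD[OF A left_absorb[OF r f h]]
  have "loose_fact A B p (h \<otimes> b) c"
    using f l hb(3)[OF b(1)] para_mult[OF para_gen[OF h(1)] b(2)] by (simp add: loose_fact_def)
  moreover have eq: "r \<otimes> (p \<otimes> y \<otimes> c) = p \<otimes> (h \<otimes> y) \<otimes> c" if "y \<in> carrier W" for y
  proof -
    have "r \<otimes> (p \<otimes> y \<otimes> c) = (r \<otimes> p) \<otimes> y \<otimes> c" using cl that rS by (simp add: m_assoc)
    then show ?thesis unfolding h(2) using cl that rS by (simp add: m_assoc)
  qed
  ultimately show ?thesis
    unfolding realizes_def using eq[OF cl(2)] eq[OF cl(4)] hb(4)[OF b(1)] by metis
qed

lemma realizes_left_mult:
  assumes f: "loose_fact A B p b c" and r: "r \<in> K - (H - A)"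
    and l: "len ((r \<otimes> p) \<otimes> b \<otimes> c) = len (r \<otimes> p) + len b + len c"
  shows "realizes A B (r \<otimes> (p \<otimes> b \<otimes> c)) (r \<otimes> (p \<otimes> M b \<otimes> c))"
proof -
  note cl = loose_fact_closed[OF f]
  have rS: "r \<in> S" using r KS by auto
  have "loose_fact A B (r \<otimes> p) b c"
    using f l para_mult[OF para_gen[OF r]] by (simp add: loose_fact_def)
  moreover have "r \<otimes> (p \<otimes> y \<otimes> c) = r \<otimes> p \<otimes> y \<otimes> c" if "y \<in> carrier W" for y
    using cl that rS by (simp add: m_assoc)
  ultimately show ?thesis unfolding realizes_def using cl by metis
qed

text \<open>The dichotomy for pb modulo J \<inter> K - H decides whether r stays on the left or
  reappears as a letter g in front of c. If it stays, the dichotomy for p modulo H decides whether r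
  joins p or becomes a letter h of the middle factor. The normal form supplies length additivity
  each time.\<close>

lemma realizes_gen_mult_right:
  assumes HK: "H \<subseteq> K" and HJ: "H \<inter> J = {s}"
    and uv: "realizes A B u v" and r: "r \<in> K - (H - A)"
  shows "realizes A B (r \<otimes> u) (r \<otimes> v)"
proof -
  obtain p b c where f: "loose_fact A B p b c" and u: "u = p \<otimes> b \<otimes> c" and v: "v = p \<otimes> M b \<otimes> c"
    and p: "p \<in> min_right W S H" and c: "c \<in> min_left W S H"
    and e: "p \<otimes> b \<in> min_right W S (J \<inter> K - H)"
    using realizes_canonical[OF uv] .
  note cl = loose_fact_closed[OF f] and pa = loose_fact_para[OF f HK]
  let ?X = "K - (H - A)" and ?Y = "J - (H - B)"
  have sub: "J \<inter> K - H \<subseteq> S" "?X \<subseteq> S" "?Y \<subseteq> S" using JS KS by auto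
  have A: "left_commuting A" and b: "b \<preceq> w\<^sub>0" "b \<in> para H" and pX: "p \<in> para ?X" and cY: "c \<in> para ?Y"
    using f by (auto simp: loose_fact_def)
  have rS: "r \<in> S" "r \<in> K" "r \<in> carrier W" using r KS by auto
  from sub(1) e rS(1) show ?thesis
  proof (cases rule: min_right_gen_cases)
    case min
    have reK: "r \<otimes> (p \<otimes> b) \<in> para K" using para_mult[OF para_gen pa(2)] rS by blast
    note len_re = len_canonical_mult[OF HJ reK min pa(3) c]
    from HS p rS(1) show ?thesis
    proof (cases rule: min_right_gen_cases)
      case min
      have "len ((r \<otimes> p) \<otimes> b \<otimes> c) = len (r \<otimes> p) + len b + len c"
        using len_re len_min_right_mult[OF HS min b(2)] cl rS by (simp add: m_assoc)
      then show ?thesis unfolding u v by (rule realizes_left_mult[OF f r])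
    next
      case (fixed h)
      have hS: "h \<in> S" using fixed HS by auto
      have "r \<otimes> (p \<otimes> b) = (r \<otimes> p) \<otimes> b" using cl rS by (simp add: m_assoc)
      also have "\<dots> = p \<otimes> (h \<otimes> b)" unfolding fixed(2) using cl hS by (simp add: m_assoc)
      finally have "len (p \<otimes> (h \<otimes> b) \<otimes> c) = len p + len (h \<otimes> b) + len c"
        using len_re len_min_right_mult[OF HS p para_mult[OF para_gen[OF fixed(1)] b(2)]] by simp
      then show ?thesis unfolding u v by (rule realizes_absorb[OF f r fixed])
    qed
  next
    case (fixed g)
    have g: "g \<in> J \<inter> K" "g \<notin> H" "g \<in> S" using fixed sub by auto
    let ?t = "b \<otimes> g \<otimes> inv b"
    have gH: "insert g H \<subseteq> S" using g HS by simp
    have bH: "b \<in> para (insert g H)" using b(2) para_mono[of H "insert g H"] by blast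
    have tH: "?t \<in> para (insert g H)"
      by (rule para_mult[OF para_mult[OF bH para_gen[OF insertI1]] para_inv[OF gH bH]])
    have re: "r \<otimes> p \<otimes> b = p \<otimes> b \<otimes> g" using fixed(2) cl rS by (simp add: m_assoc)
    \<comment> \<open>The support condition for \<open>matching_conjugation\<close> comes from r p b
      = p b g: the conjugate b g b^-1 equals p^-1 r p.\<close>
    have t: "?t = inv p \<otimes> r \<otimes> p"
    proof -
      have "inv p \<otimes> r \<otimes> p = inv p \<otimes> (r \<otimes> p \<otimes> b) \<otimes> inv b" using cl rS by (simp add: m_assoc)
      then show ?thesis unfolding re using cl g by (simp add: m_assoc)
    qed
    have "?t \<in> para ?X"
      unfolding t by (rule para_mult[OF para_mult[OF para_inv[OF sub(2) pX] para_gen[OF r]] pX])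
    then have "?t \<in> para (insert g H \<inter> ?X)" using para_Int[OF gH sub(2) tH] by blast
    then have tA: "?t \<in> para (insert g A)" using para_mono[of "insert g H \<inter> ?X" "insert g A"] by blast
    have conj: "M b \<otimes> g \<otimes> inv (M b) = ?t" by (rule matching_conjugation[OF g(1,2) A b(1) tA])
    have pass: "r \<otimes> (p \<otimes> y \<otimes> c) = p \<otimes> y \<otimes> (g \<otimes> c)" if "y \<otimes> g \<otimes> inv y = ?t" "y \<in> carrier W" for y
    proof -
      have "r \<otimes> (p \<otimes> y \<otimes> c) = p \<otimes> (inv p \<otimes> r \<otimes> p) \<otimes> y \<otimes> c" using that(2) cl rS by (simp add: m_assoc)
      then show ?thesis unfolding t[symmetric] that(1)[symmetric] using that(2) cl g by (simp add: m_assoc)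
    qed
    have gcJ: "g \<otimes> c \<in> para J" using para_mult[OF para_gen pa(3)] g by blast
    have "len (p \<otimes> b \<otimes> (g \<otimes> c)) = len p + len b + len (g \<otimes> c)"
      using len_canonical_mult[OF HJ pa(2) e gcJ min_left_gen_mult[OF HJ g(1,2) pa(3) c]]
        len_min_right_mult[OF HS p b(2)] by simp
    moreover have "g \<otimes> c \<in> para ?Y" using para_mult[OF para_gen cY] g by blast
    ultimately have "loose_fact A B p b (g \<otimes> c)" using f by (simp add: loose_fact_def)
    then show ?thesis
      unfolding realizes_def u v using pass[OF HOL.refl cl(2)] pass[OF conj cl(4)] by blast
  qed
qed

text \<open>The normal form is that of the inverse, in which p^-1 is the last factor. So r meets p
  alone, only the dichotomy for p modulo H is needed, and an absorbed letter lies in H \<inter> K =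
  {s}.\<close>

lemma realizes_gen_mult_left:
  assumes HJ: "H \<subseteq> J" and HK: "H \<inter> K = {s}"
    and uv: "realizes A B u v" and r: "r \<in> K - (H - A)"
  shows "realizes A B (r \<otimes> u) (r \<otimes> v)"
proof -
  interpret dual: matching_system W S K J H "\<lambda>x. inv (M (inv x))" s "inv w\<^sub>0" by (rule dual)
  obtain c' b' p' where f': "dual.loose_fact B A c' b' p'" and u': "inv u = c' \<otimes> b' \<otimes> p'"
    and v': "inv v = c' \<otimes> inv (M (inv b')) \<otimes> p'"
    and c': "c' \<in> min_right W S H" and p': "p' \<in> min_left W S H"
    and e': "c' \<otimes> b' \<in> min_right W S (K \<inter> J - H)"
    using dual.realizes_canonical[OF dual_realizes[OF uv]] .
  note cl' = dual.loose_fact_closed[OF f'] and pa = dual.loose_fact_para[OF f' HJ]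
  define p b c where "p = inv p'" and "b = inv b'" and "c = inv c'"
  have inv: "inv p = p'" "inv b = b'" "inv c = c'" unfolding p_def b_def c_def using cl' by auto
  have f: "loose_fact A B p b c"
    using dual_loose_fact[of p b c] f' inv cl' unfolding p_def b_def c_def by simp
  note cl = loose_fact_closed[OF f] and uvc = realizes_closed[OF uv]
  have u: "u = p \<otimes> b \<otimes> c"
    using arg_cong[OF u', of "m_inv W"] uvc cl' unfolding p_def b_def c_def
    by (simp add: inv_mult_group m_assoc)
  have v: "v = p \<otimes> M b \<otimes> c"
    using arg_cong[OF v', of "m_inv W"] uvc cl cl' unfolding p_def b_def c_def
    by (simp add: inv_mult_group m_assoc)
  have b: "b \<in> para H" "b' \<in> para H" using f f' by (auto simp: loose_fact_def dual.loose_fact_def)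
  have rS: "r \<in> S" "r \<in> K" "r \<in> carrier W" using r KS by auto
  have pmin: "p \<in> min_right W S H" using p' min_left_iff_inv[OF HS] p_def by blast
  have len3: "len (x \<otimes> y \<otimes> c) = len (c' \<otimes> inv y \<otimes> inv x)" if "x \<in> carrier W" "y \<in> carrier W" for x y
    using len_inv[of "x \<otimes> y \<otimes> c"] that cl inv by (simp add: inv_mult_group m_assoc)
  have lc: "len c' = len c" "len b' = len b" using cl inv len_inv by metis+
  have p'K: "inv x \<in> para K" "inv x \<in> min_left W S H"
    if "x \<in> para K" "x \<in> min_right W S H" for x
    using para_inv[OF KS that(1)] that(2) min_left_iff_inv[OF HS] by auto
  have pK: "p \<in> para K" using para_inv[OF KS pa(3)] unfolding p_def .
  from HS pmin rS(1) show ?thesis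
  proof (cases rule: min_right_gen_cases)
    case min
    have rpK: "r \<otimes> p \<in> para K" using para_mult[OF para_gen pK] rS by blast
    have "len (r \<otimes> p \<otimes> b \<otimes> c) = len (r \<otimes> p) + len b + len c"
      using dual.len_canonical_mult[OF HK pa(2) e' p'K[OF rpK min]]
        len_min_right_mult[OF HS c' b(2)] len3[of "r \<otimes> p" b] lc inv cl rS by simp
    then show ?thesis unfolding u v by (rule realizes_left_mult[OF f r])
  next
    case (fixed h)
    have hS: "h \<in> S" using fixed HS by auto
    have "h = inv p \<otimes> r \<otimes> p" using fixed hS cl rS by (simp add: m_assoc)
    moreover have "inv p \<otimes> r \<otimes> p \<in> para K"
      by (rule para_mult[OF para_mult[OF para_inv[OF KS pK] para_gen[OF rS(2)]] pK])
    ultimately have "h \<in> K" using para_gen_iff[OF KS hS] by simp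
    then have h: "h = s" using fixed HK by blast
    \<comment> \<open>Absorbing s preserves minimality modulo K \<inter> J - H, so
      \<open>len_canonical_mult\<close> still gives the length.\<close>
    have e'': "c' \<otimes> (b' \<otimes> s) \<in> min_right W S (K \<inter> J - H)"
      using dual.min_right_mult_s[OF e'] cl' sS by (simp add: m_assoc)
    have b's: "b' \<otimes> s \<in> para H" using para_mult[OF b(2) para_gen[OF sH]] .
    have eJ: "c' \<otimes> (b' \<otimes> s) \<in> para J"
      using para_mult[OF pa(1)] b's para_mono[OF HJ] by blast
    have sb: "inv (h \<otimes> b) = b' \<otimes> s" using h inv cl sS by (simp add: inv_mult_group)
    have "len (p \<otimes> (h \<otimes> b) \<otimes> c) = len (c' \<otimes> (b' \<otimes> s) \<otimes> p')"
      using len3[of p "h \<otimes> b"] cl hS sb inv by simp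
    also have "\<dots> = len c' + len (b' \<otimes> s) + len p'"
      using dual.len_canonical_mult[OF HK eJ e'' pa(3) p'] len_min_right_mult[OF HS c' b's] by simp
    also have "\<dots> = len p + len (h \<otimes> b) + len c"
      using sb inv cl hS len_inv[of "h \<otimes> b"] len_inv[of p] lc by simp
    finally show ?thesis unfolding u v by (rule realizes_absorb[OF f r fixed])
  qed
qed

lemma realizes_gen_mult:
  assumes "realizes A B u v" and "r \<in> K - (H - A)"
  shows "realizes A B (r \<otimes> u) (r \<otimes> v)"
  using H_side realizes_gen_mult_right[OF _ _ assms] realizes_gen_mult_left[OF _ _ assms] by blast

end

section \<open>Systems of Coxeter group elements\<close>

context coxeter_system
begin

text \<open>M(e) covers e, and a right descent of M(e) lies between the two.\<close>

lemma matching_atom: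
  assumes w0: "w\<^sub>0 \<in> carrier W" and M: "matching_of W S w\<^sub>0 M"
  shows "M \<one> \<in> S" "M \<one> \<preceq> w\<^sub>0"
proof -
  let ?P = "lower_interval W S w\<^sub>0"
  have one: "\<one> \<in> ?P" using ble_one[OF w0] by (simp add: lower_interval_def)
  from M one have s: "M \<one> \<in> ?P" and
    cov: "covers_in ?P (\<preceq>) \<one> (M \<one>) \<or> covers_in ?P (\<preceq>) (M \<one>) \<one>"
    unfolding matching_def by auto
  from s show sw: "M \<one> \<preceq> w\<^sub>0" by (simp add: lower_interval_def)
  then have sc: "M \<one> \<in> carrier W" using ble_closed by blast
  from cov have ne: "M \<one> \<noteq> \<one>" unfolding covers_in_def by metis
  then have "\<not> M \<one> \<preceq> \<one>" using ble_antisym ble_one[OF sc] by blast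
  then have cov: "\<And>z. z \<in> ?P \<Longrightarrow> \<one> \<preceq> z \<Longrightarrow> z \<preceq> M \<one> \<Longrightarrow> z = \<one> \<or> z = M \<one>"
    using cov unfolding covers_in_def by blast
  from carrier_descent_right[OF sc ne] obtain j where j: "j \<in> S" "len (M \<one>) = Suc (len (M \<one> \<otimes> j))" .
  have "j \<preceq> M \<one>" using ble_suffix[of "M \<one> \<otimes> j" j] j sc by (simp add: len_gen)
  then have "j = \<one> \<or> j = M \<one>"
    using cov[of j] ble_trans[OF _ sw] ble_one j by (simp add: lower_interval_def)
  then show "M \<one> \<in> S" using gen_neq_one j by auto
qed

lemma para_commuting_pair:
  assumes st: "s \<in> S" "t \<in> S" "s \<otimes> t = t \<otimes> s" and x: "x \<in> para {s, t}"
  shows "x \<in> {\<one>, s, t, s \<otimes> t}"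
  using x
proof induction
  case (eng h1 h2)
  have c: "s \<in> carrier W" "t \<in> carrier W" using st by auto
  have "t \<otimes> (s \<otimes> t) = s" "s \<otimes> t \<otimes> s = t" unfolding st(3) using st(1,2) by simp_all
  moreover from this(1) have "s \<otimes> t \<otimes> (s \<otimes> t) = \<one>" using st(1,2) by (simp add: m_assoc gen_sq)
  ultimately show ?case using eng st(1,2) st(3)[symmetric] c by (auto simp: gen_sq)
qed (use st in auto)

text \<open>Among e, s, t and st, the matching exchanges e and s, so t and st can only be exchanged
  with each other: this is left multiplication by s. By [S0], a two-element H therefore cannot
  commute.\<close>

lemma commuting_pair_matching:
  assumes st: "s \<in> S" "t \<in> S" "s \<noteq> t" "s \<otimes> t = t \<otimes> s"
    and w0: "w\<^sub>0 \<in> para {s, t}" and M: "matching_of W S w\<^sub>0 M" and s: "M \<one> = s"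
  shows "multiplication_matching_of W S w\<^sub>0 M"
proof -
  have sub: "{s, t} \<subseteq> S" using st by simp
  have c: "s \<in> carrier W" "t \<in> carrier W" "w\<^sub>0 \<in> carrier W"
    using st para_closed[OF sub w0] by auto
  have inv: "M (M x) = x" and closed: "M x \<preceq> w\<^sub>0" and ne: "M x \<noteq> x" if "x \<preceq> w\<^sub>0" for x
    using M that unfolding matching_def covers_in_def lower_interval_def by (blast, blast, force)
  have one: "\<one> \<preceq> w\<^sub>0" using ble_one c by simp
  have Ms: "M s = \<one>" using inv[OF one] s by simp
  have sw: "s \<preceq> w\<^sub>0" using closed[OF one] s by simp
  have elems: "x \<in> {\<one>, s, t, s \<otimes> t}" if "x \<preceq> w\<^sub>0" for x
    using para_commuting_pair[OF st(1,2,4)] para_down[OF sub that w0] by blast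
  have d: "t \<noteq> \<one>" "s \<noteq> \<one>" "s \<otimes> t \<noteq> s" "s \<otimes> t \<noteq> \<one>" "s \<otimes> t \<noteq> t"
  proof -
    show "t \<noteq> \<one>" "s \<noteq> \<one>" using gen_neq_one st by auto
    then show "s \<otimes> t \<noteq> s" "s \<otimes> t \<noteq> t" using c by auto
    show "s \<otimes> t \<noteq> \<one>" using gen_cancel[OF st(1) c(2)] c st(3) by auto
  qed
  have "M x = s \<otimes> x" if x: "x \<preceq> w\<^sub>0" for x
  proof -
    have Mx: "M x = \<one> \<or> M x = s \<or> M x = t \<or> M x = s \<otimes> t" using elems[OF closed[OF x]] by simp
    have M1: "M x = \<one> \<Longrightarrow> x = s" and M2: "M x = s \<Longrightarrow> x = \<one>" using inv[OF x] s Ms by auto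
    from elems[OF x] consider "x = \<one>" | "x = s" | "x = t" | "x = s \<otimes> t" by blast
    then show ?thesis
    proof cases
      case 3
      then show ?thesis using Mx M1 M2 ne[OF x] st(3) d(1) by metis
    next
      case 4
      then have "M x = t" using Mx M1 M2 ne[OF x] d(3,4) by metis
      then show ?thesis using 4 st(1) c by simp
    qed (use s Ms c st(1) in \<open>simp_all add: gen_sq\<close>)
  qed
  moreover have "len (s \<otimes> w\<^sub>0) < len w\<^sub>0"
  proof -
    have "\<not> s \<preceq> t"
      using para_down[of "{t}" s t] para_gen[of t "{t}"] para_gen_iff[of "{t}" s] st by auto
    moreover have "\<not> s \<preceq> \<one>" using ble_eq_or_len_less[of s \<one>] d by auto
    ultimately have "w\<^sub>0 = s \<or> w\<^sub>0 = s \<otimes> t" using elems[OF ble_refl[OF c(3)]] sw by auto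
    moreover have "len t < len (s \<otimes> t)"
      using len_gen_mult_neq[OF st(1) c(2)] len_eq_0_iff[of "s \<otimes> t"] d c st by (simp add: len_gen)
    ultimately show ?thesis using st(1,2) c by (auto simp: gen_sq len_gen)
  qed
  ultimately show ?thesis
    using st unfolding multiplication_matching_of_def left_descents_def lower_interval_def by blast
qed

lemma matching_system_of_system:
  assumes w: "w \<in> carrier W" and sys: "is_system W S w J H M"
  shows "matching_system W S J (complement W S (M \<one>) J) H M (M \<one>) (max_parabolic W S H w)"
proof -
  let ?w0 = "max_parabolic W S H w" and ?s = "M \<one>" and ?K = "complement W S (M \<one>) J"
  have HS: "H \<subseteq> S" and card: "card H \<in> {1, 2}" and M: "matching_of W S ?w0 M"
    and J: "commuting_gens W S ?s \<subseteq> J" "J \<subseteq> S"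
    and mult: "multiplication_matching_of W S ?w0 M \<longleftrightarrow> card H = 1"
    using sys unfolding is_system_def Let_def by auto
  have K: "?K = (S - J) \<union> commuting_gens W S ?s" by (rule complement_eq[OF J])
  have CS: "commuting_gens W S ?s \<subseteq> S" by (auto simp: commuting_gens_def)
  note w0 = max_parabolic(1)[OF HS w]
  have w0c: "?w0 \<in> carrier W" using para_closed[OF HS w0] .
  note atom = matching_atom[OF w0c M]
  have sH: "?s \<in> H" using para_down[OF HS atom(2) w0] para_gen_iff[OF HS atom(1)] by blast
  have form: "H = {?s} \<or> (\<exists>t. H = {?s, t} \<and> ?s \<otimes> t \<noteq> t \<otimes> ?s)"
  proof (cases "card H = 1")
    case True
    then show ?thesis using sH by (auto simp: card_1_singleton_iff)
  next
    case False
    then have "card H = 2" using card by simp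
    then obtain x y where "H = {x, y}" "x \<noteq> y" by (auto simp: card_2_iff)
    then obtain t where t: "H = {?s, t}" "?s \<noteq> t" using sH by auto
    have "?s \<otimes> t \<noteq> t \<otimes> ?s"
    proof
      assume "?s \<otimes> t = t \<otimes> ?s"
      then have "multiplication_matching_of W S ?w0 M"
        using commuting_pair_matching[of ?s t ?w0 M] atom HS t w0 M by auto
      then show False using mult False by simp
    qed
    then show ?thesis using t by blast
  qed
  show ?thesis
  proof unfold_locales
    show "J \<subseteq> S" "?K \<subseteq> S" "J \<inter> ?K = commuting_gens W S ?s" "H \<subseteq> J \<union> ?K"
      using J CS HS unfolding K by auto
    show "M x \<preceq> ?w0" "M (M x) = x" if "x \<preceq> ?w0" for x
      using M that unfolding matching_def lower_interval_def by blast+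
  qed (use atom form w0 in auto)
qed

end

section \<open>The system map of a fixed element\<close>

locale element_system = matching_system +
  fixes w :: 'a
  assumes w_closed: "w \<in> carrier W"
    and w0_eq: "w\<^sub>0 = max_parabolic W S H w"
    and K_eq: "K = complement W S s J"
begin

lemma system_factorization_iff:
  "system_factorization W S w J H M u a b c \<longleftrightarrow>
    u = a \<otimes> b \<otimes> c \<and> len u = len a + len b + len c \<and>
    a \<in> para K \<and> a \<in> min_right W S H \<and> left_commuting (supp W S a \<inter> H) \<and> b \<in> para H \<and>
    c \<in> para J \<and> c \<in> min_left W S H \<and> right_commuting (supp W S c \<inter> H)"
  unfolding system_factorization_def Let_def M_one K_eq[symmetric] w0_eq[symmetric]
    left_commuting_def right_commuting_def
  by auto

lemma left_commuting_mono: "left_commuting A \<Longrightarrow> A' \<subseteq> A \<Longrightarrow> left_commuting A'"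
  unfolding left_commuting_def
  using card_mono[of A A'] finite_subset[of A H] H_form by fastforce

lemma right_commuting_mono: "right_commuting B \<Longrightarrow> B' \<subseteq> B \<Longrightarrow> right_commuting B'"
  unfolding right_commuting_def
  using card_mono[of B B'] finite_subset[of B H] H_form by fastforce

text \<open>Supports shrink when passing to a' below a, so the H-support of a is an admissible bound
  for every such a'.\<close>

lemma para_restrict:
  assumes "L \<subseteq> S" "a \<in> para L" "a' \<preceq> a"
  shows "a' \<in> para (L - (H - supp W S a \<inter> H))"
proof -
  have "a \<in> carrier W" using assms ble_closed by blast
  then have "a' \<in> para (supp W S a)" "a' \<in> para L"
    using para_down[OF supp_subset assms(3)] para_supp para_down[OF assms(1,3,2)] by auto
  then have "a' \<in> para (L \<inter> supp W S a)" using para_Int[OF assms(1) supp_subset] by blast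
  then show ?thesis using para_mono[of "L \<inter> supp W S a" "L - (H - supp W S a \<inter> H)"] by blast
qed

lemma supp_restrict:
  assumes "L \<subseteq> S" "a \<in> para (L - (H - A))"
  shows "supp W S a \<inter> H \<subseteq> A"
proof -
  have "L - (H - A) \<subseteq> S" using assms by blast
  then show ?thesis using para_iff_supp[of "L - (H - A)" a] para_closed assms by blast
qed

lemma system_factorization_below:
  assumes u: "u \<preceq> w" and "system_factorization W S w J H M u a b c"
  shows "b \<preceq> w\<^sub>0"
proof -
  note f = assms(2)[unfolded system_factorization_iff]
  have cl: "a \<in> carrier W" "b \<in> carrier W" "c \<in> carrier W" using f para_closed[OF HS] by auto
  have l: "len (a \<otimes> b \<otimes> c) = len a + len b + len c" using f by auto
  have "len (a \<otimes> b) = len a + len b"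
    using l len_mult_le[of "a \<otimes> b" c] len_mult_le[of a b] cl by simp
  then have "b \<preceq> a \<otimes> b" "a \<otimes> b \<preceq> a \<otimes> b \<otimes> c"
    using ble_suffix[of a b] ble_prefix[of "a \<otimes> b" c] l cl by auto
  then have "b \<preceq> w" using f u ble_trans by blast
  then show "b \<preceq> w\<^sub>0" using max_parabolic(3)[OF HS w_closed] f unfolding w0_eq by blast
qed

lemma system_factorization_realizes:
  assumes u: "u \<preceq> w" and fact: "system_factorization W S w J H M u a b c"
  shows "realizes (supp W S a \<inter> H) (supp W S c \<inter> H) u (a \<otimes> M b \<otimes> c)"
proof -
  note f = fact[unfolded system_factorization_iff]
  have cl: "a \<in> carrier W" "c \<in> carrier W" and l: "len (a \<otimes> b \<otimes> c) = len a + len b + len c"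
    using f by auto
  have "b \<preceq> w\<^sub>0" by (rule system_factorization_below[OF assms])
  then have "loose_fact (supp W S a \<inter> H) (supp W S c \<inter> H) a b c"
    unfolding loose_fact_def
    using f l para_restrict[OF KS _ ble_refl] para_restrict[OF JS _ ble_refl] cl by blast
  then show ?thesis unfolding realizes_def using f by blast
qed

text \<open>The normal form of a loose factorization is an S-factorization with the same value,
  which gives existence. Conversely every S-factorization of u is loose, so uniqueness follows from
  \<open>realizes_unique\<close>.\<close>

lemma system_map_eq:
  assumes u: "u \<preceq> w" and v: "realizes A B u v"
  shows "system_map W S w J H M u = v"
  unfolding system_map_def
proof (rule the_equality)
  obtain a b c where f: "loose_fact A B a b c" "u = a \<otimes> b \<otimes> c" "v = a \<otimes> M b \<otimes> c"
    "a \<in> min_right W S H" "c \<in> min_left W S H"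
    using realizes_canonical[OF v] by metis
  have p: "a \<in> para (K - (H - A))" "c \<in> para (J - (H - B))" "left_commuting A" "right_commuting B"
    "b \<in> para H" "len u = len a + len b + len c"
    using f(1,2) by (auto simp: loose_fact_def)
  have "left_commuting (supp W S a \<inter> H)" "right_commuting (supp W S c \<inter> H)"
    using supp_restrict[OF KS p(1)] supp_restrict[OF JS p(2)] left_commuting_mono[OF p(3)]
      right_commuting_mono[OF p(4)] by blast+
  moreover have "a \<in> para K" "c \<in> para J"
    using para_mono[OF Diff_subset p(1)] para_mono[OF Diff_subset p(2)] by auto
  ultimately have "system_factorization W S w J H M u a b c"
    unfolding system_factorization_iff using f p by blast
  then show "\<exists>a b c. system_factorization W S w J H M u a b c \<and> v = a \<otimes> M b \<otimes> c"
    using f(3) by blast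
next
  fix v' assume "\<exists>a b c. system_factorization W S w J H M u a b c \<and> v' = a \<otimes> M b \<otimes> c"
  then show "v' = v"
    using system_factorization_realizes[OF u] realizes_unique[OF _ v] by blast
qed

end

theorem theorem5p1:
  fixes W :: "('a, 'b) monoid_scheme" (structure)
    and S J H :: "'a set" and M :: "'a \<Rightarrow> 'a"
    and w a b c u a' b' c' :: 'a
  assumes "coxeter_system W S"
    and "w \<in> carrier W"
    and "is_system W S w J H M"
    and "system_factorization W S w J H M w a b c"
    and "bruhat_le W S u w"
    and "u = a' \<otimes> b' \<otimes> c'"
    and "bruhat_le W S a' a" and "bruhat_le W S b' b" and "bruhat_le W S c' c"
    and "cox_length W S u = cox_length W S a' + cox_length W S b' + cox_length W S c'
      \<or> (special_matching_of W S w (system_map W S w J H M) \<and>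
         (\<exists>r \<in> left_descents W S a.
            cox_length W S (r \<otimes> u) =
              cox_length W S (r \<otimes> a') + cox_length W S b' + cox_length W S c'))"
  shows "system_map W S w J H M u = a' \<otimes> M b' \<otimes> c'"
proof -
  interpret coxeter_system W S by fact
  let ?K = "complement W S (M \<one>) J" and ?w0 = "max_parabolic W S H w"
  interpret element_system W S J ?K H M "M \<one>" ?w0 w
    by (intro element_system.intro matching_system_of_system assms element_system_axioms.intro HOL.refl)
  let ?A = "supp W S a \<inter> H" and ?B = "supp W S c \<inter> H"
  let ?X = "?K - (H - ?A)" and ?Y = "J - (H - ?B)"
  note f = assms(4)[unfolded system_factorization_iff]
  have X: "?X \<subseteq> S" using KS by blast
  have aX: "a \<in> para ?X" "a' \<in> para ?X" and cY: "c' \<in> para ?Y"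
    using para_restrict[OF KS] para_restrict[OF JS] f ble_refl assms(7,9) min_right_closed by blast+
  have b: "b' \<in> para H" "b' \<preceq> ?w0"
    using ble_trans[OF assms(8) system_factorization_below[OF ble_refl[OF assms(2)] assms(4)]] below_w0
    by auto
  have cl: "a' \<in> carrier W" "b' \<in> carrier W" "c' \<in> carrier W" "M b' \<in> carrier W"
    using assms(7-9) ble_closed below_M[OF b(2)] by auto
  have fact: "loose_fact ?A ?B x b' c'"
    if "x \<in> para ?X" "len (x \<otimes> b' \<otimes> c') = len x + len b' + len c'" for x
    unfolding loose_fact_def using that f b cY by blast
  from assms(10) have "realizes ?A ?B u (a' \<otimes> M b' \<otimes> c')"
  proof (elim disjE conjE bexE)
    assume "len u = len a' + len b' + len c'"
    then have "loose_fact ?A ?B a' b' c'" using fact[OF aX(2)] assms(6) by simp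
    then show ?thesis unfolding realizes_def using assms(6) by blast
  next
    fix r assume r: "r \<in> left_descents W S a"
      and l: "len (r \<otimes> u) = len (r \<otimes> a') + len b' + len c'"
    have rS: "r \<in> S" "len (r \<otimes> a) < len a" using r by (auto simp: left_descents_def)
    \<comment> \<open>As a reflection shortening a, r lies in every parabolic subgroup containing a,
      in particular in the one cut out by the bound on a.\<close>
    have rX: "r \<in> ?X"
      using para_refl_left[OF X aX(1) gen_refl[OF rS(1)] rS(2)] para_gen_iff[OF X rS(1)] by blast
    have ru: "r \<otimes> u = (r \<otimes> a') \<otimes> b' \<otimes> c'" "r \<otimes> (r \<otimes> u) = u"
      "r \<otimes> ((r \<otimes> a') \<otimes> M b' \<otimes> c') = a' \<otimes> M b' \<otimes> c'"
      unfolding assms(6) using cl rS by (simp_all add: m_assoc)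
    have "loose_fact ?A ?B (r \<otimes> a') b' c'"
      using fact[OF para_mult[OF para_gen[OF rX] aX(2)]] l unfolding ru(1) by simp
    then have "realizes ?A ?B (r \<otimes> u) ((r \<otimes> a') \<otimes> M b' \<otimes> c')"
      unfolding realizes_def using ru(1) by blast
    \<comment> \<open>r is an involution: multiplying the factorization of ru by r returns to u, and
      its value to a' M(b') c'.\<close>
    from realizes_gen_mult[OF this rX] show ?thesis unfolding ru(2,3) .
  qed
  then show ?thesis using system_map_eq[OF assms(5)] by blast
qed

end
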